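(* Let $(M,\varphi,\xi,\eta,g)$ be a Kenmotsu pseudo-metric manifold of dimension $3$, with $g(\xi,\xi)=\varepsilon\in\{1,-1\}$. If $(g,V)$ is a Ricci soliton for some vector field $V$ on $M$, then $M$ is of constant curvature $-\varepsilon$.
   Context: Let $M$ be a smooth manifold of dimension $2n+1$ (here $n=1$). An almost contact pseudo-metric structure $(\varphi,\xi,\eta,g)$ on $M$ consists of a $(1,1)$-tensor field $\varphi$, a vector field $\xi$, a 1-form $\eta$ and a pseudo-Riemannian metric $g$ such that $\varphi^2=-I+\eta\otimes\xi$, $\eta(\xi)=1$, $\varphi\xi=0$, $\eta\circ\varphi=0$, and $g(\varphi X,\varphi Y)=g(X,Y)-\varepsilon\eta(X)\eta(Y)$ for all vector fields $X,Y$, where $\varepsilon=\pm1$; consequently $\eta(X)=\varepsilon g(X,\xi)$, $g(\varphi X,Y)=-g(X,\varphi Y)$ and $g(\xi,\xi)=\varepsilon$. It is a Kenmotsu pseudo-metric manifold if $(\nabla_X\varphi)Y=-\eta(Y)\varphi X-\varepsilon g(X,\varphi Y)\xi$ for all $X,Y$, where $\nabla$ is the Levi-Civita connection of $g$. Curvature: $R(X,Y)=[\nabla_X,\nabla_Y]-\nabla_{[X,Y]}$; $Ric(Y,Z)$ is the trace of $X\mapsto R(X,Y)Z$. For a vector field $V$ on $M$, $(g,V)$ is a Ricci soliton if there is a constant $\lambda\in\mathbb{R}$ with $(\pounds_Vg)(X,Y)+2Ric(X,Y)+2\lambda g(X,Y)=0$ for all $X,Y$, where $\pounds$ is the Lie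 derivative. Constant curvature $k$ means $R(X,Y)Z=k\{g(Y,Z)X-g(X,Z)Y\}$ for all $X,Y,Z$. *)

theory Defs
  imports "HOL-Analysis.Analysis" "HOL-Library.Function_Algebras"
begin

section \<open>Smooth manifolds\<close>

text \<open>
  Differentiability of class \<open>k\<close> on an open set of a Euclidean space: all iterated directional
  derivatives up to order \<open>k\<close> exist (as Frechet derivatives) and are continuous.
\<close>

primrec Ck_on ::
  "nat \<Rightarrow> ('a::euclidean_space \<Rightarrow> 'b::real_normed_vector) \<Rightarrow> 'a set \<Rightarrow> bool" where
  "Ck_on 0 f S \<longleftrightarrow> continuous_on S f"
| "Ck_on (Suc k) f S \<longleftrightarrow>
     (\<forall>x\<in>S. f differentiable (at x)) \<and> (\<forall>v. Ck_on k (\<lambda>x. frechet_derivative f (at x) v) S)"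

definition smooth_on ::
  "('a::euclidean_space \<Rightarrow> 'b::real_normed_vector) \<Rightarrow> 'a set \<Rightarrow> bool" where
  "smooth_on f S \<longleftrightarrow> (\<forall>k. Ck_on k f S)"

text \<open>
  A chart is a pair of a coordinate domain and a coordinate map; the map is relevant on the domain
  only. The dimension of the manifold is the cardinality of the index type. The atlas need not be
  maximal: it generates the smooth structure, and the notions below do not change
  when compatible charts are added to it.
\<close>

type_synonym ('a, 'n) chart = "'a set \<times> ('a \<Rightarrow> real ^ 'n)"

record ('a, 'n) manifold =
  mtop :: "'a topology"
  atlas :: "('a, 'n) chart set"

abbreviation points :: "('a, 'n::finite) manifold \<Rightarrow> 'a set" where
  "points M \<equiv> topspace (mtop M)"

definition smooth_manifold :: "('a, 'n::finite) manifold \<Rightarrow> bool" where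
  "smooth_manifold M \<longleftrightarrow>
     Hausdorff_space (mtop M) \<and> second_countable (mtop M) \<and>
     (\<forall>(U, h)\<in>atlas M. openin (mtop M) U \<and> open (h ` U) \<and>
        homeomorphic_map (subtopology (mtop M) U) (top_of_set (h ` U)) h) \<and>
     (\<Union>(U, h)\<in>atlas M. U) = points M \<and>
     (\<forall>(U, h)\<in>atlas M. \<forall>(W, k)\<in>atlas M.
        smooth_on (k \<circ> inv_into U h) (h ` (U \<inter> W)))"

definition smooth_fun_on :: "('a, 'n::finite) manifold \<Rightarrow> 'a set \<Rightarrow> ('a \<Rightarrow> real) \<Rightarrow> bool" where
  "smooth_fun_on M W f \<longleftrightarrow> (\<forall>(U, h)\<in>atlas M. smooth_on (f \<circ> inv_into U h) (h ` (U \<inter> W)))"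

abbreviation smooth_fun :: "('a, 'n::finite) manifold \<Rightarrow> ('a \<Rightarrow> real) \<Rightarrow> bool" where
  "smooth_fun M f \<equiv> smooth_fun_on M (points M) f"

definition smooth_near :: "('a, 'n::finite) manifold \<Rightarrow> 'a \<Rightarrow> ('a \<Rightarrow> real) \<Rightarrow> bool" where
  "smooth_near M p f \<longleftrightarrow> (\<exists>W. openin (mtop M) W \<and> p \<in> W \<and> smooth_fun_on M W f)"


section \<open>Tangent vectors and vector fields\<close>

text \<open>
  A tangent vector at \<open>p\<close> is the directional derivative at \<open>p\<close>, in some chart, of functions that are
  smooth near \<open>p\<close>. Functions that are not smooth near \<open>p\<close> are sent to \<open>0\<close>, so that equality of
  tangent vectors is equality in HOL. Sums, differences and the zero vector are the pointwise
  operations on functions.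
\<close>

type_synonym 'a tangent = "('a \<Rightarrow> real) \<Rightarrow> real"

definition chart_tangent ::
  "('a, 'n::finite) manifold \<Rightarrow> ('a, 'n) chart \<Rightarrow> 'a \<Rightarrow> real ^ 'n \<Rightarrow> 'a tangent" where
  "chart_tangent M c p v = (\<lambda>f. if smooth_near M p f
     then frechet_derivative (f \<circ> inv_into (fst c) (snd c)) (at (snd c p)) v else 0)"

definition tangent_space :: "('a, 'n::finite) manifold \<Rightarrow> 'a \<Rightarrow> 'a tangent set" where
  "tangent_space M p = {chart_tangent M c p v | c v. c \<in> atlas M \<and> p \<in> fst c}"

definition scale_tangent :: "real \<Rightarrow> 'a tangent \<Rightarrow> 'a tangent" where
  "scale_tangent a u = (\<lambda>f. a * u f)"

text \<open>
  A vector field is smooth if its components with respect to every chart are smooth. Vector fields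
  are \<open>0\<close> outside the manifold, so that their equality, too, is equality in HOL.
\<close>

type_synonym 'a vfield = "'a \<Rightarrow> 'a tangent"

definition vector_field :: "('a, 'n::finite) manifold \<Rightarrow> 'a vfield \<Rightarrow> bool" where
  "vector_field M X \<longleftrightarrow>
     (\<forall>p\<in>points M. X p \<in> tangent_space M p) \<and> (\<forall>p. p \<notin> points M \<longrightarrow> X p = 0) \<and>
     (\<forall>(U, h)\<in>atlas M. \<forall>i. smooth_fun_on M U (\<lambda>p. X p (\<lambda>q. h q $ i)))"

definition scale_field :: "('a \<Rightarrow> real) \<Rightarrow> 'a vfield \<Rightarrow> 'a vfield" where
  "scale_field f X = (\<lambda>p. scale_tangent (f p) (X p))"

definition lie_bracket :: "('a, 'n::finite) manifold \<Rightarrow> 'a vfield \<Rightarrow> 'a vfield \<Rightarrow> 'a vfield" where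
  "lie_bracket M X Y = (\<lambda>p f. if smooth_near M p f
     then X p (\<lambda>q. Y q f) - Y p (\<lambda>q. X q f) else 0)"


section \<open>Tensor fields\<close>

definition one_form :: "('a, 'n::finite) manifold \<Rightarrow> ('a \<Rightarrow> 'a tangent \<Rightarrow> real) \<Rightarrow> bool" where
  "one_form M \<eta> \<longleftrightarrow>
     (\<forall>p\<in>points M. \<forall>u\<in>tangent_space M p. \<forall>v\<in>tangent_space M p. \<forall>a.
        \<eta> p (u + v) = \<eta> p u + \<eta> p v \<and> \<eta> p (scale_tangent a u) = a * \<eta> p u) \<and>
     (\<forall>X. vector_field M X \<longrightarrow> smooth_fun M (\<lambda>p. \<eta> p (X p)))"

definition endo_apply ::
  "('a, 'n::finite) manifold \<Rightarrow> ('a \<Rightarrow> 'a tangent \<Rightarrow> 'a tangent) \<Rightarrow> 'a vfield \<Rightarrow> 'a vfield" where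
  "endo_apply M \<phi> X = (\<lambda>p. if p \<in> points M then \<phi> p (X p) else 0)"

definition endo_field ::
  "('a, 'n::finite) manifold \<Rightarrow> ('a \<Rightarrow> 'a tangent \<Rightarrow> 'a tangent) \<Rightarrow> bool" where
  "endo_field M \<phi> \<longleftrightarrow>
     (\<forall>p\<in>points M. \<forall>u\<in>tangent_space M p. \<forall>v\<in>tangent_space M p. \<forall>a.
        \<phi> p u \<in> tangent_space M p \<and>
        \<phi> p (u + v) = \<phi> p u + \<phi> p v \<and> \<phi> p (scale_tangent a u) = scale_tangent a (\<phi> p u)) \<and>
     (\<forall>X. vector_field M X \<longrightarrow> vector_field M (endo_apply M \<phi> X))"

text \<open>The signature is not restricted.\<close>

definition pseudo_riemannian_metric ::
  "('a, 'n::finite) manifold \<Rightarrow> ('a \<Rightarrow> 'a tangent \<Rightarrow> 'a tangent \<Rightarrow> real) \<Rightarrow> bool" where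
  "pseudo_riemannian_metric M g \<longleftrightarrow>
     (\<forall>p\<in>points M.
        (\<forall>u\<in>tangent_space M p. \<forall>v\<in>tangent_space M p. \<forall>w\<in>tangent_space M p. \<forall>a.
           g p u v = g p v u \<and>
           g p (u + v) w = g p u w + g p v w \<and> g p (scale_tangent a u) w = a * g p u w) \<and>
        (\<forall>u\<in>tangent_space M p. (\<forall>v\<in>tangent_space M p. g p u v = 0) \<longrightarrow> u = 0)) \<and>
     (\<forall>X Y. vector_field M X \<longrightarrow> vector_field M Y \<longrightarrow> smooth_fun M (\<lambda>p. g p (X p) (Y p)))"


section \<open>Levi-Civita connection and curvature\<close>

definition affine_connection ::
  "('a, 'n::finite) manifold \<Rightarrow> ('a vfield \<Rightarrow> 'a vfield \<Rightarrow> 'a vfield) \<Rightarrow> bool" where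
  "affine_connection M nabla \<longleftrightarrow>
     (\<forall>X Y. vector_field M X \<longrightarrow> vector_field M Y \<longrightarrow> vector_field M (nabla X Y)) \<and>
     (\<forall>X Y Z. vector_field M X \<longrightarrow> vector_field M Y \<longrightarrow> vector_field M Z \<longrightarrow>
        nabla (X + Y) Z = nabla X Z + nabla Y Z \<and> nabla X (Y + Z) = nabla X Y + nabla X Z) \<and>
     (\<forall>f X Y. smooth_fun M f \<longrightarrow> vector_field M X \<longrightarrow> vector_field M Y \<longrightarrow>
        nabla (scale_field f X) Y = scale_field f (nabla X Y) \<and>
        nabla X (scale_field f Y) = scale_field (\<lambda>p. X p f) Y + scale_field f (nabla X Y))"

definition levi_civita ::
  "('a, 'n::finite) manifold \<Rightarrow> ('a \<Rightarrow> 'a tangent \<Rightarrow> 'a tangent \<Rightarrow> real) \<Rightarrow>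
   ('a vfield \<Rightarrow> 'a vfield \<Rightarrow> 'a vfield) \<Rightarrow> bool" where
  "levi_civita M g nabla \<longleftrightarrow>
     affine_connection M nabla \<and>
     (\<forall>X Y. vector_field M X \<longrightarrow> vector_field M Y \<longrightarrow> nabla X Y - nabla Y X = lie_bracket M X Y) \<and>
     (\<forall>X Y Z. vector_field M X \<longrightarrow> vector_field M Y \<longrightarrow> vector_field M Z \<longrightarrow>
        (\<forall>p\<in>points M. X p (\<lambda>q. g q (Y q) (Z q)) = g p (nabla X Y p) (Z p) + g p (Y p) (nabla X Z p)))"

definition curvature ::
  "('a, 'n::finite) manifold \<Rightarrow> ('a vfield \<Rightarrow> 'a vfield \<Rightarrow> 'a vfield) \<Rightarrow>
   'a vfield \<Rightarrow> 'a vfield \<Rightarrow> 'a vfield \<Rightarrow> 'a vfield" where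
  "curvature M nabla X Y Z =
     nabla X (nabla Y Z) - nabla Y (nabla X Z) - nabla (lie_bracket M X Y) Z"

text \<open>
  The trace of a linear endomorphism \<open>L\<close> of the tangent space at \<open>p\<close>, computed in the coordinate
  basis of an arbitrary chart around \<open>p\<close>: the \<open>i\<close>-th component of a tangent vector is its value on
  the \<open>i\<close>-th coordinate function.
\<close>

definition tangent_trace ::
  "('a, 'n::finite) manifold \<Rightarrow> 'a \<Rightarrow> ('a tangent \<Rightarrow> 'a tangent) \<Rightarrow> real" where
  "tangent_trace M p L =
     (let c = (SOME c. c \<in> atlas M \<and> p \<in> fst c)
      in \<Sum>i\<in>UNIV. L (chart_tangent M c p (axis i 1)) (\<lambda>q. snd c q $ i))"

text \<open>
  The trace of \<open>X \<mapsto> R(X,Y)Z\<close> at \<open>p\<close>. The endomorphism is evaluated on a tangent vector by extending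
  the latter to a vector field; by tensoriality the choice of the extension does not matter.
\<close>

definition ricci ::
  "('a, 'n::finite) manifold \<Rightarrow> ('a vfield \<Rightarrow> 'a vfield \<Rightarrow> 'a vfield) \<Rightarrow>
   'a vfield \<Rightarrow> 'a vfield \<Rightarrow> 'a \<Rightarrow> real" where
  "ricci M nabla Y Z p =
     tangent_trace M p (\<lambda>u. curvature M nabla (SOME X. vector_field M X \<and> X p = u) Y Z p)"

definition constant_curvature ::
  "('a, 'n::finite) manifold \<Rightarrow> ('a \<Rightarrow> 'a tangent \<Rightarrow> 'a tangent \<Rightarrow> real) \<Rightarrow>
   ('a vfield \<Rightarrow> 'a vfield \<Rightarrow> 'a vfield) \<Rightarrow> real \<Rightarrow> bool" where
  "constant_curvature M g nabla k \<longleftrightarrow>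
     (\<forall>X Y Z. vector_field M X \<longrightarrow> vector_field M Y \<longrightarrow> vector_field M Z \<longrightarrow>
        curvature M nabla X Y Z =
          scale_field (\<lambda>p. k) (scale_field (\<lambda>p. g p (Y p) (Z p)) X - scale_field (\<lambda>p. g p (X p) (Z p)) Y))"


section \<open>Ricci solitons\<close>

definition lie_derivative_metric ::
  "('a, 'n::finite) manifold \<Rightarrow> 'a vfield \<Rightarrow> ('a \<Rightarrow> 'a tangent \<Rightarrow> 'a tangent \<Rightarrow> real) \<Rightarrow>
   'a vfield \<Rightarrow> 'a vfield \<Rightarrow> 'a \<Rightarrow> real" where
  "lie_derivative_metric M V g X Y p =
     V p (\<lambda>q. g q (X q) (Y q)) - g p (lie_bracket M V X p) (Y p) - g p (X p) (lie_bracket M V Y p)"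

definition ricci_soliton ::
  "('a, 'n::finite) manifold \<Rightarrow> ('a \<Rightarrow> 'a tangent \<Rightarrow> 'a tangent \<Rightarrow> real) \<Rightarrow>
   ('a vfield \<Rightarrow> 'a vfield \<Rightarrow> 'a vfield) \<Rightarrow> 'a vfield \<Rightarrow> bool" where
  "ricci_soliton M g nabla V \<longleftrightarrow>
     vector_field M V \<and>
     (\<exists>lam::real. \<forall>X Y. vector_field M X \<longrightarrow> vector_field M Y \<longrightarrow> (\<forall>p\<in>points M.
        lie_derivative_metric M V g X Y p + 2 * ricci M nabla X Y p + 2 * lam * g p (X p) (Y p) = 0))"


section \<open>Kenmotsu pseudo-metric manifolds\<close>

definition almost_contact_pseudo_metric ::
  "('a, 'n::finite) manifold \<Rightarrow> ('a \<Rightarrow> 'a tangent \<Rightarrow> 'a tangent) \<Rightarrow> 'a vfield \<Rightarrow>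
   ('a \<Rightarrow> 'a tangent \<Rightarrow> real) \<Rightarrow> ('a \<Rightarrow> 'a tangent \<Rightarrow> 'a tangent \<Rightarrow> real) \<Rightarrow> real \<Rightarrow> bool" where
  "almost_contact_pseudo_metric M \<phi> \<xi> \<eta> g \<epsilon> \<longleftrightarrow>
     endo_field M \<phi> \<and> vector_field M \<xi> \<and> one_form M \<eta> \<and> pseudo_riemannian_metric M g \<and>
     \<epsilon> \<in> {1, -1} \<and>
     (\<forall>p\<in>points M.
        (\<forall>u\<in>tangent_space M p. \<phi> p (\<phi> p u) = - u + scale_tangent (\<eta> p u) (\<xi> p)) \<and>
        \<eta> p (\<xi> p) = 1 \<and> \<phi> p (\<xi> p) = 0 \<and>
        (\<forall>u\<in>tangent_space M p. \<eta> p (\<phi> p u) = 0)) \<and>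
     (\<forall>X Y. vector_field M X \<longrightarrow> vector_field M Y \<longrightarrow> (\<forall>p\<in>points M.
        g p (\<phi> p (X p)) (\<phi> p (Y p)) = g p (X p) (Y p) - \<epsilon> * \<eta> p (X p) * \<eta> p (Y p)))"

text \<open>\<open>(\<nabla>\<^sub>X \<phi>) Y = \<nabla>\<^sub>X (\<phi> Y) - \<phi> (\<nabla>\<^sub>X Y)\<close>\<close>

definition cov_deriv_endo ::
  "('a, 'n::finite) manifold \<Rightarrow> ('a vfield \<Rightarrow> 'a vfield \<Rightarrow> 'a vfield) \<Rightarrow>
   ('a \<Rightarrow> 'a tangent \<Rightarrow> 'a tangent) \<Rightarrow> 'a vfield \<Rightarrow> 'a vfield \<Rightarrow> 'a vfield" where
  "cov_deriv_endo M nabla \<phi> X Y =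
     nabla X (endo_apply M \<phi> Y) - endo_apply M \<phi> (nabla X Y)"

definition kenmotsu_pseudo_metric ::
  "('a, 'n::finite) manifold \<Rightarrow> ('a \<Rightarrow> 'a tangent \<Rightarrow> 'a tangent) \<Rightarrow> 'a vfield \<Rightarrow>
   ('a \<Rightarrow> 'a tangent \<Rightarrow> real) \<Rightarrow> ('a \<Rightarrow> 'a tangent \<Rightarrow> 'a tangent \<Rightarrow> real) \<Rightarrow> real \<Rightarrow>
   ('a vfield \<Rightarrow> 'a vfield \<Rightarrow> 'a vfield) \<Rightarrow> bool" where
  "kenmotsu_pseudo_metric M \<phi> \<xi> \<eta> g \<epsilon> nabla \<longleftrightarrow>
     almost_contact_pseudo_metric M \<phi> \<xi> \<eta> g \<epsilon> \<and>
     (\<forall>X Y. vector_field M X \<longrightarrow> vector_field M Y \<longrightarrow>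
        cov_deriv_endo M nabla \<phi> X Y =
          - scale_field (\<lambda>p. \<eta> p (Y p)) (endo_apply M \<phi> X)
          - scale_field (\<lambda>p. \<epsilon> * g p (X p) (\<phi> p (Y p))) \<xi>)"

end

theory Submission
  imports Defs
begin

text \<open>
  Write \<open>\<langle>X,Y\<rangle>\<close> for \<open>g(X,Y)\<close>, call a vector field horizontal if it is orthogonal to \<open>\<xi>\<close>, and let \<open>X'\<close> be
  the horizontal part \<open>X - \<eta>(X)\<xi>\<close> of \<open>X\<close>.

  The Kenmotsu identity applied to \<open>\<xi>\<close> gives \<open>\<nabla>\<^sub>X \<xi> = X'\<close>, hence \<open>R(X,Y)\<xi> = \<eta>(X)Y - \<eta>(Y)X\<close>. With the
  symmetries of the curvature tensor this fixes every component of \<open>R\<close> that has an argument \<open>\<xi>\<close>. In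
  dimension three the horizontal spaces are planes, so only one component is left, and
  \<open>R(X,Y)Z = - \<epsilon> (\<langle>Y,Z\<rangle>X - \<langle>X,Z\<rangle>Y) - \<kappa> \<langle>\<Phi>X,Y\<rangle> \<Phi>Z\<close>
  for a smooth function \<open>\<kappa>\<close>, where \<open>\<Phi>\<close> is the structure tensor acting on fields (\<open>curvature_kappa\<close>). The
  claim is \<open>\<kappa> = 0\<close>. Geometrically, \<open>M\<close> is locally a warped product with metric
  \<open>\<epsilon> dt\<^sup>2 + e\<^bsup>2t\<^esup> h\<close> over a surface, and \<open>\<kappa>\<close> is \<open>e\<^bsup>-2t\<^esup>\<close> times the Gauss curvature of \<open>h\<close>; this is reflected
  in \<open>\<xi> \<kappa> = - 2 \<kappa>\<close>, which the second Bianchi identity yields (\<open>kappa_xi\<close>).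

  Tracing \<open>R\<close> turns the soliton equation into
  \<open>\<langle>\<nabla>\<^sub>X V, Y\<rangle> + \<langle>X, \<nabla>\<^sub>Y V\<rangle> = 2 c \<langle>X,Y\<rangle> - 2 \<kappa> \<langle>X',Y'\<rangle>\<close> with the constant \<open>c = 2 \<epsilon> - \<lambda>\<close>.
  It fixes the symmetric part of \<open>\<nabla>V\<close>; the skew part consists of a horizontal field \<open>Q\<close> and a function \<open>w\<close>, the
  speed of rotation in the horizontal planes (\<open>nabla_V\<close>). Equating \<open>R(X,Y)V\<close>, computed from this formula,
  with its known value determines the derivatives of \<open>Q\<close> and \<open>w\<close> in turn (\<open>nabla_Q\<close>, \<open>dir_xi_w\<close>, \<open>dir_w\<close>), so that
  the system closes. Let \<open>v = \<eta>(V)\<close>, \<open>W = V'\<close> and \<open>G = \<epsilon> (Q + W)\<close>, the horizontal part of the gradient of \<open>v\<close>. The same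
  comparison for \<open>R(X,Y)G\<close> yields \<open>c = 0\<close> and \<open>X \<kappa> = (\<epsilon>/2) \<kappa> \<langle>X,G\<rangle>\<close> for horizontal \<open>X\<close>.

  Finally the mixed second derivatives of \<open>w\<close> have to agree. This is an algebraic identity \<open>\<kappa> \<psi> = 0\<close>, where
  \<open>\<psi>\<close> is a polynomial in \<open>v\<close>, \<open>\<langle>G,W\<rangle>\<close> and \<open>\<langle>G,G\<rangle>\<close> (\<open>kappa_identity_1\<close>). Along horizontal fields \<open>\<kappa>\<close> is multiplied by a
  function, so the derivative of \<open>\<kappa> \<psi>\<close> is \<open>\<kappa>\<close> times the derivative of \<open>\<psi>\<close> up to a multiple of \<open>\<kappa> \<psi>\<close> itself. Differentiating
  three times and eliminating leads to \<open>\<kappa> G = 0\<close> (\<open>kappa_gradient\<close>), and one more derivative to \<open>\<kappa>\<^sup>2 = 0\<close>. As the factor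
  \<open>\<kappa>\<close> is carried along, all these identities hold on the whole of \<open>M\<close>, not just where \<open>\<kappa> \<noteq> 0\<close>.

  All computations use global vector fields. A tensor is a function-linear map, and
  evaluating it on a frame rests on \<open>frame_expansion\<close>, an identity between global fields that remains
  true where the frame degenerates. Global fields with a prescribed value at a point, which the
  definition of the Ricci tensor presupposes, come from bump functions (\<open>vector_field_extension\<close>).
\<close>

section \<open>Functions of class Ck\<close>

lemma Ck_on_cong:
  assumes "open S" "Ck_on k f S" "\<And>x. x \<in> S \<Longrightarrow> f x = g x"
  shows "Ck_on k g S"
  using assms(2,3)
proof (induction k arbitrary: f g)
  case 0
  then show ?case by (simp cong: continuous_on_cong)
next
  case (Suc k)
  have d: "f differentiable (at x)" if "x \<in> S" for x using Suc.prems that by simp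
  have D: "frechet_derivative g (at x) = frechet_derivative f (at x)" if "x \<in> S" for x
    using frechet_derivative_transform_within_open[OF d[OF that] \<open>open S\<close> that] Suc.prems by auto
  have "g differentiable (at x)" if "x \<in> S" for x
    using d[OF that] has_derivative_transform_within_open[OF _ \<open>open S\<close> that] Suc.prems(2)
    unfolding differentiable_def by blast
  moreover have "Ck_on k (\<lambda>x. frechet_derivative g (at x) v) S" for v
    using Suc.IH[of "\<lambda>x. frechet_derivative f (at x) v"] Suc.prems D by auto
  ultimately show ?case by simp
qed

lemma Ck_on_subset: "Ck_on k f S \<Longrightarrow> T \<subseteq> S \<Longrightarrow> Ck_on k f T"
  by (induction k arbitrary: f) (auto intro: continuous_on_subset)

lemma Ck_on_local:
  assumes "\<And>x. x \<in> S \<Longrightarrow> \<exists>T. open T \<and> x \<in> T \<and> Ck_on k f T"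
  shows "Ck_on k f S"
  using assms
proof (induction k arbitrary: f)
  case 0
  have "isCont f x" if "x \<in> S" for x
    using 0[OF that] by (auto simp: continuous_on_eq_continuous_at)
  then show ?case by (simp add: continuous_at_imp_continuous_on)
next
  case (Suc k)
  have "f differentiable (at x)" if "x \<in> S" for x
    using Suc.prems[OF that] by auto
  moreover have "Ck_on k (\<lambda>x. frechet_derivative f (at x) v) S" for v
  proof (rule Suc.IH)
    fix x assume "x \<in> S"
    from Suc.prems[OF this] show "\<exists>T. open T \<and> x \<in> T \<and> Ck_on k (\<lambda>x. frechet_derivative f (at x) v) T"
      by auto
  qed
  ultimately show ?case by simp
qed

lemma Ck_on_Suc_imp: "Ck_on (Suc k) f S \<Longrightarrow> Ck_on k f S"
proof (induction k arbitrary: f)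
  case 0
  then show ?case
    by (auto intro!: continuous_at_imp_continuous_on differentiable_imp_continuous_within)
next
  case (Suc k)
  then show ?case by simp
qed

lemma Ck_on_const: "Ck_on k (\<lambda>x. c) S"
  by (induction k arbitrary: c) auto

text \<open>
  The form in which differentiability classes are established: a formula for the derivative is
  enough, and the chosen \<open>frechet_derivative\<close> no longer occurs.
\<close>

lemma Ck_on_deriv:
  assumes "open S" "\<And>x. x \<in> S \<Longrightarrow> (f has_derivative f' x) (at x)" "\<And>v. Ck_on k (\<lambda>x. f' x v) S"
  shows "Ck_on (Suc k) f S"
proof -
  have "f' x = frechet_derivative f (at x)" if "x \<in> S" for x
    using assms(2)[OF that] by (rule frechet_derivative_at)
  then have "Ck_on k (\<lambda>x. frechet_derivative f (at x) v) S" for v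
    by (intro Ck_on_cong[OF assms(1) assms(3)[of v]]) simp
  moreover have "f differentiable (at x)" if "x \<in> S" for x
    using assms(2)[OF that] by (auto simp: differentiable_def)
  ultimately show ?thesis by simp
qed

lemma Ck_on_SucD:
  assumes "Ck_on (Suc k) f S" "x \<in> S"
  shows "(f has_derivative frechet_derivative f (at x)) (at x)"
  using assms frechet_derivative_works by auto

lemma Ck_on_add:
  assumes "open S" "Ck_on k f S" "Ck_on k g S"
  shows "Ck_on k (\<lambda>x. f x + g x) S"
  using assms(2,3)
proof (induction k arbitrary: f g)
  case 0
  then show ?case by (simp add: continuous_on_add)
next
  case (Suc k)
  show ?case
  proof (rule Ck_on_deriv[OF assms(1)])
    show "((\<lambda>x. f x + g x) has_derivative
        (\<lambda>v. frechet_derivative f (at x) v + frechet_derivative g (at x) v)) (at x)" if "x \<in> S" for x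
      by (rule has_derivative_add[OF Ck_on_SucD[OF Suc.prems(1) that] Ck_on_SucD[OF Suc.prems(2) that]])
  qed (use Suc in simp)
qed

lemma Ck_on_sum:
  assumes "open S" "\<And>i. i \<in> I \<Longrightarrow> Ck_on k (f i) S"
  shows "Ck_on k (\<lambda>x. \<Sum>i\<in>I. f i x) S"
  using assms(2)
  by (induction I rule: infinite_finite_induct) (auto intro: Ck_on_const Ck_on_add[OF assms(1)])

lemma Ck_on_bounded_linear:
  assumes "bounded_linear L" "open S" "Ck_on k f S"
  shows "Ck_on k (\<lambda>x. L (f x)) S"
  using assms(3)
proof (induction k arbitrary: f)
  case 0
  then show ?case by (simp add: bounded_linear.continuous_on[OF assms(1)])
next
  case (Suc k)
  show ?case
  proof (rule Ck_on_deriv[OF assms(2)])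
    show "((\<lambda>x. L (f x)) has_derivative (\<lambda>v. L (frechet_derivative f (at x) v))) (at x)"
      if "x \<in> S" for x
      by (rule bounded_linear.has_derivative[OF assms(1) Ck_on_SucD[OF Suc.prems that]])
  qed (use Suc in simp)
qed

lemma Ck_on_scaleR:
  fixes a :: "'a::euclidean_space \<Rightarrow> real"
  assumes "open S" "Ck_on k a S" "Ck_on k f S"
  shows "Ck_on k (\<lambda>x. a x *\<^sub>R f x) S"
  using assms(2,3)
proof (induction k arbitrary: a f)
  case 0
  then show ?case by (simp add: continuous_on_scaleR)
next
  case (Suc k)
  show ?case
  proof (rule Ck_on_deriv[OF assms(1)])
    show "((\<lambda>x. a x *\<^sub>R f x) has_derivative
        (\<lambda>v. a x *\<^sub>R frechet_derivative f (at x) v + frechet_derivative a (at x) v *\<^sub>R f x)) (at x)"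
      if "x \<in> S" for x
      by (rule has_derivative_scaleR[OF Ck_on_SucD[OF Suc.prems(1) that] Ck_on_SucD[OF Suc.prems(2) that]])
    show "Ck_on k (\<lambda>x. a x *\<^sub>R frechet_derivative f (at x) v + frechet_derivative a (at x) v *\<^sub>R f x) S" for v
      using Suc.prems Ck_on_Suc_imp[OF Suc.prems(1)] Ck_on_Suc_imp[OF Suc.prems(2)]
      by (intro Ck_on_add[OF assms(1)] Suc.IH) simp_all
  qed
qed

lemma Ck_on_mult:
  fixes a b :: "'a::euclidean_space \<Rightarrow> real"
  assumes "open S" "Ck_on k a S" "Ck_on k b S"
  shows "Ck_on k (\<lambda>x. a x * b x) S"
  using Ck_on_scaleR[OF assms] by simp

lemma Ck_on_inverse:
  fixes a :: "'a::euclidean_space \<Rightarrow> real"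
  assumes "open S" "Ck_on k a S" "\<And>x. x \<in> S \<Longrightarrow> a x \<noteq> 0"
  shows "Ck_on k (\<lambda>x. inverse (a x)) S"
  using assms(2)
proof (induction k)
  case 0
  then show ?case using assms(3) by (simp add: continuous_on_inverse)
next
  case (Suc k)
  show ?case
  proof (rule Ck_on_deriv[OF assms(1)])
    show "((\<lambda>x. inverse (a x)) has_derivative
        (\<lambda>v. - (inverse (a x) * frechet_derivative a (at x) v * inverse (a x)))) (at x)"
      if "x \<in> S" for x
      by (rule Deriv.has_derivative_inverse[OF assms(3)[OF that] Ck_on_SucD[OF Suc.prems that]])
    have k: "Ck_on k (\<lambda>x. inverse (a x)) S" using Suc Ck_on_Suc_imp by blast
    show "Ck_on k (\<lambda>x. - (inverse (a x) * frechet_derivative a (at x) v * inverse (a x))) S" for v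
      using Suc.prems k
      by (intro Ck_on_bounded_linear[OF bounded_linear_minus[OF bounded_linear_ident] assms(1)]
           Ck_on_mult[OF assms(1)]) auto
  qed
qed

text \<open>
  Induction on the order works because, by the chain rule, the derivative of the composition is a
  sum of products of the components of \<open>Dh\<close> with partial derivatives of \<open>f\<close> composed with \<open>h\<close>, all of
  which are one order less smooth.
\<close>

lemma Ck_on_compose:
  fixes f :: "'b::euclidean_space \<Rightarrow> 'c::real_normed_vector" and h :: "'a::euclidean_space \<Rightarrow> 'b"
  assumes "open S" "open T" "Ck_on k f T" "Ck_on k h S" "h ` S \<subseteq> T"
  shows "Ck_on k (\<lambda>x. f (h x)) S"
  using assms(3,4)
proof (induction k arbitrary: f)
  case 0
  then show ?case using continuous_on_compose2[of T f S h] assms(5) by simp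
next
  case (Suc k)
  let ?f' = "\<lambda>x. frechet_derivative f (at x)" and ?h' = "\<lambda>x. frechet_derivative h (at x)"
  have h: "Ck_on k h S" using Suc.prems(2) by (rule Ck_on_Suc_imp)
  show ?case
  proof (rule Ck_on_deriv[OF assms(1)])
    fix x assume x: "x \<in> S"
    then have hx: "h x \<in> T" using assms(5) by auto
    have df: "(f has_derivative ?f' (h x)) (at (h x))" by (rule Ck_on_SucD[OF Suc.prems(1) hx])
    have "((\<lambda>x. f (h x)) has_derivative (\<lambda>v. ?f' (h x) (?h' x v))) (at x)"
      by (rule has_derivative_compose[OF Ck_on_SucD[OF Suc.prems(2) x] df])
    moreover
    have "?f' (h x) u = (\<Sum>b\<in>Basis. (u \<bullet> b) *\<^sub>R ?f' (h x) b)" for u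
    proof -
      have l: "linear (?f' (h x))" using df by (rule has_derivative_linear)
      have "?f' (h x) u = ?f' (h x) (\<Sum>b\<in>Basis. (u \<bullet> b) *\<^sub>R b)"
        by (simp add: euclidean_representation)
      then show ?thesis by (simp add: linear_sum[OF l] linear_scale[OF l])
    qed
    then have "?f' (h x) (?h' x v) = (\<Sum>b\<in>Basis. (?h' x v \<bullet> b) *\<^sub>R ?f' (h x) b)" for v .
    ultimately show "((\<lambda>x. f (h x)) has_derivative
        (\<lambda>v. \<Sum>b\<in>Basis. (?h' x v \<bullet> b) *\<^sub>R ?f' (h x) b)) (at x)"
      by (simp only:)
  next
    fix v
    show "Ck_on k (\<lambda>x. \<Sum>b\<in>Basis. (?h' x v \<bullet> b) *\<^sub>R ?f' (h x) b) S"
    proof (intro Ck_on_sum Ck_on_scaleR assms(1))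
      fix b :: 'b
      show "Ck_on k (\<lambda>x. ?h' x v \<bullet> b) S"
        using Suc.prems(2) by (intro Ck_on_bounded_linear[OF bounded_linear_inner_left assms(1)]) simp
      show "Ck_on k (\<lambda>x. ?f' (h x) b) S"
        using Suc.IH[of "\<lambda>y. ?f' y b"] Suc.prems(1) h by simp
    qed
  qed
qed

lemma smooth_on_cong:
  "open S \<Longrightarrow> smooth_on f S \<Longrightarrow> (\<And>x. x \<in> S \<Longrightarrow> f x = g x) \<Longrightarrow> smooth_on g S"
  unfolding smooth_on_def using Ck_on_cong by blast

lemma smooth_on_subset: "smooth_on f S \<Longrightarrow> T \<subseteq> S \<Longrightarrow> smooth_on f T"
  unfolding smooth_on_def using Ck_on_subset by blast

lemma smooth_on_local:
  assumes "\<And>x. x \<in> S \<Longrightarrow> \<exists>T. open T \<and> x \<in> T \<and> smooth_on f T"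
  shows "smooth_on f S"
  unfolding smooth_on_def
proof (intro allI Ck_on_local)
  fix k x assume "x \<in> S"
  from assms[OF this] show "\<exists>T. open T \<and> x \<in> T \<and> Ck_on k f T"
    unfolding smooth_on_def by blast
qed

lemma smooth_on_const: "smooth_on (\<lambda>x. c) S"
  by (simp add: smooth_on_def Ck_on_const)

lemma smooth_on_add:
  "open S \<Longrightarrow> smooth_on f S \<Longrightarrow> smooth_on g S \<Longrightarrow> smooth_on (\<lambda>x. f x + g x) S"
  by (simp add: smooth_on_def Ck_on_add)

lemma smooth_on_mult:
  fixes f g :: "'a::euclidean_space \<Rightarrow> real"
  shows "open S \<Longrightarrow> smooth_on f S \<Longrightarrow> smooth_on g S \<Longrightarrow> smooth_on (\<lambda>x. f x * g x) S"
  by (simp add: smooth_on_def Ck_on_mult)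

lemma smooth_on_inverse:
  fixes f :: "'a::euclidean_space \<Rightarrow> real"
  shows "open S \<Longrightarrow> smooth_on f S \<Longrightarrow> (\<And>x. x \<in> S \<Longrightarrow> f x \<noteq> 0) \<Longrightarrow> smooth_on (\<lambda>x. inverse (f x)) S"
  by (simp add: smooth_on_def Ck_on_inverse)

lemma smooth_on_bounded_linear:
  "bounded_linear L \<Longrightarrow> open S \<Longrightarrow> smooth_on f S \<Longrightarrow> smooth_on (\<lambda>x. L (f x)) S"
  by (simp add: smooth_on_def Ck_on_bounded_linear)

lemma smooth_on_compose:
  fixes f :: "'b::euclidean_space \<Rightarrow> 'c::real_normed_vector" and h :: "'a::euclidean_space \<Rightarrow> 'b"
  shows "open S \<Longrightarrow> open T \<Longrightarrow> smooth_on f T \<Longrightarrow> smooth_on h S \<Longrightarrow> h ` S \<subseteq> T \<Longrightarrow>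
    smooth_on (\<lambda>x. f (h x)) S"
  by (simp add: smooth_on_def Ck_on_compose)

lemma smooth_on_has_derivative:
  assumes "smooth_on f S" "x \<in> S"
  shows "(f has_derivative frechet_derivative f (at x)) (at x)"
  using assms Ck_on_SucD[of 0] unfolding smooth_on_def by blast

lemma smooth_on_frechet_derivative:
  assumes "smooth_on f S"
  shows "smooth_on (\<lambda>x. frechet_derivative f (at x) v) S"
  unfolding smooth_on_def
proof
  fix k
  have "Ck_on (Suc k) f S" using assms unfolding smooth_on_def by blast
  then show "Ck_on k (\<lambda>x. frechet_derivative f (at x) v) S" by simp
qed

section \<open>Bump functions\<close>

text \<open>
  The functions \<open>x\<^bsup>-n\<^esup> e\<^bsup>-1/x\<^esup>\<close>, extended by \<open>0\<close> to \<open>x \<le> 0\<close>. Derivatives of members of this family are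
  linear combinations of two other members, so smoothness of all of them follows by a simultaneous
  induction, and formulas for higher derivatives are avoided.
\<close>

definition flat :: "nat \<Rightarrow> real \<Rightarrow> real" where
  "flat n x = (if x \<le> 0 then 0 else inverse x ^ n * exp (- inverse x))"

lemma flat_tendsto_0: "((\<lambda>x. inverse x ^ n * exp (- inverse x)) \<longlongrightarrow> (0::real)) (at_right 0)"
proof -
  have "((\<lambda>y. y ^ n / exp y) \<longlongrightarrow> (0::real)) at_top" by (rule tendsto_power_div_exp_0)
  then have "((\<lambda>x. inverse x ^ n / exp (inverse x)) \<longlongrightarrow> (0::real)) (at_right 0)"
    by (rule filterlim_compose) (rule filterlim_inverse_at_top_right)
  then show ?thesis by (simp add: exp_minus divide_inverse)
qed

lemma flat_has_real_derivative:
  "(flat n has_real_derivative (flat (n + 2) x - real n * flat (n + 1) x)) (at x)"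
proof -
  consider "x < 0" | "x > 0" | "x = 0" by linarith
  then show ?thesis
  proof cases
    case 1
    have "((\<lambda>x. 0) has_real_derivative 0) (at x)" by simp
    then have "(flat n has_real_derivative 0) (at x)"
      by (rule has_field_derivative_transform_within_open[of _ _ _ "{..<0}"])
         (use 1 in \<open>auto simp: flat_def\<close>)
    with 1 show ?thesis by (simp add: flat_def)
  next
    case 2
    have "((\<lambda>x. inverse x ^ n * exp (- inverse x)) has_real_derivative
        (real n * inverse x ^ (n - 1) * (- (inverse x * inverse x)) * exp (- inverse x)
          + inverse x ^ n * (exp (- inverse x) * (inverse x * inverse x)))) (at x)"
      using 2 by (auto intro!: derivative_eq_intros)
    also have "real n * inverse x ^ (n - 1) * (- (inverse x * inverse x)) * exp (- inverse x)
          + inverse x ^ n * (exp (- inverse x) * (inverse x * inverse x))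
        = flat (n + 2) x - real n * flat (n + 1) x"
      using 2 by (cases n) (simp_all add: flat_def algebra_simps)
    finally show ?thesis
      by (rule has_field_derivative_transform_within_open[of _ _ _ "{0<..}"])
         (use 2 in \<open>auto simp: flat_def\<close>)
  next
    case 3
    have "((\<lambda>h. (flat n h - flat n 0) / h) \<longlongrightarrow> 0) (at 0)"
    proof (rule filterlim_split_at_real)
      show "((\<lambda>h. (flat n h - flat n 0) / h) \<longlongrightarrow> 0) (at_left 0)"
        by (rule tendsto_eventually) (auto simp: eventually_at_filter flat_def)
      have "\<forall>\<^sub>F x in at_right 0. inverse x ^ (n + 1) * exp (- inverse x) = (flat n x - flat n 0) / x"
        by (auto simp: eventually_at_filter flat_def field_simps)
      then show "((\<lambda>h. (flat n h - flat n 0) / h) \<longlongrightarrow> 0) (at_right 0)"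
        by (rule Lim_transform_eventually[OF flat_tendsto_0])
    qed
    with 3 show ?thesis by (simp add: DERIV_def flat_def)
  qed
qed

lemma Ck_on_flat: "Ck_on k (flat n) UNIV"
proof (induction k arbitrary: n)
  case 0
  have "isCont (flat n) x" for x
    using flat_has_real_derivative by (rule DERIV_isCont)
  then show ?case by (simp add: continuous_at_imp_continuous_on)
next
  case (Suc k)
  show ?case
  proof (rule Ck_on_deriv)
    show "(flat n has_derivative (\<lambda>v. v * (flat (n + 2) x + - real n * flat (n + 1) x))) (at x)" for x
      using flat_has_real_derivative[of n x] unfolding has_field_derivative_def
      by (simp add: mult.commute[of _ "flat (Suc (Suc n)) x - real n * flat (Suc n) x"] mult_commute_abs)
    show "Ck_on k (\<lambda>x. v * (flat (n + 2) x + - real n * flat (n + 1) x)) UNIV" for v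
      by (intro Ck_on_mult Ck_on_add Ck_on_const Suc) simp_all
  qed simp
qed

lemma smooth_on_ident: "smooth_on (\<lambda>x. x) (S::'a::euclidean_space set)"
proof -
  have "Ck_on k (\<lambda>x::'a. x) UNIV" for k
  proof (cases k)
    case (Suc j)
    then show ?thesis
      using Ck_on_deriv[of UNIV "\<lambda>x::'a. x" "\<lambda>_ v. v" j] by (simp add: Ck_on_const)
  qed simp
  then show ?thesis using smooth_on_subset[of _ UNIV S] by (auto simp: smooth_on_def)
qed

text \<open>
  The function \<open>e\<^bsup>-1/s\<^esup>\<close> of \<open>s = r\<^sup>2 - |x - x0|\<^sup>2\<close>, normalised at the centre, where it
  will serve to prescribe a value.
\<close>

lemma bump_exists:
  fixes x0 :: "'a::euclidean_space"
  assumes "r > 0"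
  shows "\<exists>b::'a \<Rightarrow> real. smooth_on b UNIV \<and> b x0 = 1 \<and> (\<forall>x. x \<notin> ball x0 r \<longrightarrow> b x = 0)"
proof (intro exI conjI allI impI)
  let ?q = "\<lambda>x. r\<^sup>2 + - 1 * (\<Sum>i\<in>Basis. (x \<bullet> i - x0 \<bullet> i) * (x \<bullet> i - x0 \<bullet> i))"
  let ?b = "\<lambda>x. inverse (flat 0 (r\<^sup>2)) * flat 0 (?q x)"
  have q: "?q x = r\<^sup>2 - (dist x0 x)\<^sup>2" for x
  proof -
    have "(dist x0 x)\<^sup>2 = (x - x0) \<bullet> (x - x0)"
      using power2_norm_eq_inner[of "x - x0"] by (simp add: dist_norm norm_minus_commute)
    also have "\<dots> = (\<Sum>i\<in>Basis. (x \<bullet> i - x0 \<bullet> i) * (x \<bullet> i - x0 \<bullet> i))"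
      by (subst euclidean_inner) (simp add: inner_diff_left)
    finally show ?thesis by simp
  qed
  have "Ck_on k (\<lambda>x::'a. x \<bullet> i) UNIV" for i k
    using smooth_on_bounded_linear[OF bounded_linear_inner_left open_UNIV smooth_on_ident]
    unfolding smooth_on_def by blast
  then have "Ck_on k ?q UNIV" for k
    unfolding diff_conv_add_uminus
    by (intro Ck_on_add Ck_on_sum Ck_on_mult Ck_on_const) auto
  then have "Ck_on k (\<lambda>x. flat 0 (?q x)) UNIV" for k
    by (intro Ck_on_compose[OF _ _ Ck_on_flat]) auto
  then show "smooth_on ?b UNIV"
    unfolding smooth_on_def by (intro allI Ck_on_mult Ck_on_const) auto
  have "flat 0 (r\<^sup>2) \<noteq> 0" using assms by (simp add: flat_def)
  then show "?b x0 = 1" by (simp add: q)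
  show "?b x = 0" if "x \<notin> ball x0 r" for x
    using that assms unfolding q by (simp add: flat_def power_mono)
qed

section \<open>Smooth functions on a manifold\<close>

locale smooth_mfd =
  fixes M :: "('a, 'n::finite) manifold"
  assumes smooth_manifold: "smooth_manifold M"
begin

lemma chart_openin: "(U, h) \<in> atlas M \<Longrightarrow> openin (mtop M) U"
  and chart_homeo: "(U, h) \<in> atlas M \<Longrightarrow>
    homeomorphic_map (subtopology (mtop M) U) (top_of_set (h ` U)) h"
  and chart_open: "(U, h) \<in> atlas M \<Longrightarrow> open (h ` U)"
  and Hausdorff: "Hausdorff_space (mtop M)"
  and transition: "(U, h) \<in> atlas M \<Longrightarrow> (U', h') \<in> atlas M \<Longrightarrow>
    smooth_on (h' \<circ> inv_into U h) (h ` (U \<inter> U'))"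
  using smooth_manifold unfolding smooth_manifold_def by auto

lemma chart_subset: "(U, h) \<in> atlas M \<Longrightarrow> U \<subseteq> points M"
  using chart_openin openin_subset by blast

lemma chart_at:
  assumes "p \<in> points M"
  obtains U h where "(U, h) \<in> atlas M" "p \<in> U"
proof -
  have "p \<in> (\<Union>(U, h)\<in>atlas M. U)"
    using assms smooth_manifold unfolding smooth_manifold_def by simp
  with that show ?thesis by blast
qed

lemma chart_inj:
  assumes "(U, h) \<in> atlas M"
  shows "inj_on h U"
proof -
  have "points M \<inter> U = U" using chart_subset[OF assms] by blast
  then show ?thesis
    using homeomorphic_imp_injective_map[OF chart_homeo[OF assms]] by simp
qed

lemma chart_inv: "(U, h) \<in> atlas M \<Longrightarrow> p \<in> U \<Longrightarrow> inv_into U h (h p) = p"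
  using chart_inj inv_into_f_f by metis

lemma chart_image_open:
  assumes "(U, h) \<in> atlas M" "openin (mtop M) W" "W \<subseteq> U"
  shows "open (h ` W)"
proof -
  have "openin (subtopology (mtop M) U) W"
    using assms chart_openin openin_open_subtopology by blast
  then have "openin (top_of_set (h ` U)) (h ` W)"
    using homeomorphic_map_openness[OF chart_homeo[OF assms(1)], of W] openin_subset by blast
  then show ?thesis
    using chart_open[OF assms(1)] openin_open_trans by blast
qed

lemma chart_image_open_Int:
  "(U, h) \<in> atlas M \<Longrightarrow> openin (mtop M) W \<Longrightarrow> open (h ` (U \<inter> W))"
  by (rule chart_image_open) (auto intro: chart_openin)

lemma smooth_fun_on_subset: "smooth_fun_on M W f \<Longrightarrow> W' \<subseteq> W \<Longrightarrow> smooth_fun_on M W' f"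
  unfolding smooth_fun_on_def by (fastforce elim!: smooth_on_subset)

text \<open>
  Smoothness needs to be verified in one chart only; the other charts are reached by transition
  maps.
\<close>

lemma smooth_fun_on_chart:
  assumes "(U, h) \<in> atlas M" "openin (mtop M) W" "W \<subseteq> U" "smooth_on (f \<circ> inv_into U h) (h ` W)"
  shows "smooth_fun_on M W f"
  unfolding smooth_fun_on_def
proof safe
  fix U' h' assume c: "(U', h') \<in> atlas M"
  let ?S = "h' ` (U' \<inter> W)"
  have S: "open ?S" using c assms(2) by (rule chart_image_open_Int)
  have inv: "inv_into U h (h q) = q" "inv_into U' h' (h' q) = q" if "q \<in> U' \<inter> W" for q
    using that assms(3) chart_inv[OF assms(1)] chart_inv[OF c] by auto
  have "smooth_on (\<lambda>x. (f \<circ> inv_into U h) ((h \<circ> inv_into U' h') x)) ?S"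
  proof (rule smooth_on_compose[OF S _ assms(4)])
    show "open (h ` W)" using assms(1-3) by (rule chart_image_open)
    show "smooth_on (h \<circ> inv_into U' h') ?S"
      by (rule smooth_on_subset[OF transition[OF c assms(1)]]) (use assms(3) in blast)
    show "(h \<circ> inv_into U' h') ` ?S \<subseteq> h ` W" using inv by auto
  qed
  then show "smooth_on (f \<circ> inv_into U' h') ?S"
    by (rule smooth_on_cong[OF S]) (use inv in auto)
qed

lemma smooth_fun_on_chartD:
  assumes "smooth_fun_on M W f" "(U, h) \<in> atlas M"
  shows "smooth_on (f \<circ> inv_into U h) (h ` (U \<inter> W))"
  using assms unfolding smooth_fun_on_def by blast

lemma smooth_near_on: "smooth_fun_on M W f \<Longrightarrow> openin (mtop M) W \<Longrightarrow> p \<in> W \<Longrightarrow> smooth_near M p f"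
  unfolding smooth_near_def by blast

lemma smooth_near_smooth_fun: "smooth_fun M f \<Longrightarrow> p \<in> points M \<Longrightarrow> smooth_near M p f"
  by (rule smooth_near_on) simp_all

lemma smooth_fun_on_if_near:
  assumes "\<And>p. p \<in> W \<Longrightarrow> smooth_near M p f"
  shows "smooth_fun_on M W f"
  unfolding smooth_fun_on_def
proof safe
  fix U h assume c: "(U, h) \<in> atlas M"
  show "smooth_on (f \<circ> inv_into U h) (h ` (U \<inter> W))"
  proof (rule smooth_on_local)
    fix x assume "x \<in> h ` (U \<inter> W)"
    then obtain q where q: "q \<in> U" "q \<in> W" "x = h q" by blast
    from assms[OF q(2)] obtain W' where W': "openin (mtop M) W'" "q \<in> W'" "smooth_fun_on M W' f"
      unfolding smooth_near_def by blast
    show "\<exists>T. open T \<and> x \<in> T \<and> smooth_on (f \<circ> inv_into U h) T"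
      using chart_image_open_Int[OF c W'(1)] smooth_fun_on_chartD[OF W'(3) c] q W'(2) by blast
  qed
qed

lemma smooth_near_chart:
  assumes "smooth_near M p f" "(U, h) \<in> atlas M" "p \<in> U"
  obtains W where "openin (mtop M) W" "p \<in> W" "W \<subseteq> U" "smooth_fun_on M W f"
    "smooth_on (f \<circ> inv_into U h) (h ` W)" "open (h ` W)"
proof -
  obtain W where W: "openin (mtop M) W" "p \<in> W" "smooth_fun_on M W f"
    using assms(1) unfolding smooth_near_def by blast
  show ?thesis
  proof (rule that[of "U \<inter> W"])
    show "openin (mtop M) (U \<inter> W)" using W chart_openin[OF assms(2)] by blast
    show "smooth_fun_on M (U \<inter> W) f" using W(3) by (rule smooth_fun_on_subset) blast
    show "smooth_on (f \<circ> inv_into U h) (h ` (U \<inter> W))" by (rule smooth_fun_on_chartD[OF W(3) assms(2)])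
    show "open (h ` (U \<inter> W))" by (rule chart_image_open_Int[OF assms(2) W(1)])
  qed (use W assms in auto)
qed

lemma smooth_fun_on_cong:
  assumes "openin (mtop M) W" "smooth_fun_on M W f" "\<And>q. q \<in> W \<Longrightarrow> f q = f' q"
  shows "smooth_fun_on M W f'"
  unfolding smooth_fun_on_def
proof safe
  fix U h assume c: "(U, h) \<in> atlas M"
  show "smooth_on (f' \<circ> inv_into U h) (h ` (U \<inter> W))"
    by (rule smooth_on_cong[OF chart_image_open_Int[OF c assms(1)] smooth_fun_on_chartD[OF assms(2) c]])
       (use assms(3) chart_inv[OF c] in auto)
qed

lemma smooth_near_cong:
  assumes "smooth_near M p f" "openin (mtop M) W" "p \<in> W" "\<And>q. q \<in> W \<Longrightarrow> f q = f' q"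
  shows "smooth_near M p f'"
proof -
  obtain W' where W': "openin (mtop M) W'" "p \<in> W'" "smooth_fun_on M W' f"
    using assms(1) unfolding smooth_near_def by blast
  have o: "openin (mtop M) (W \<inter> W')" using assms(2) W'(1) by blast
  have "smooth_fun_on M (W \<inter> W') f'"
    by (rule smooth_fun_on_cong[OF o smooth_fun_on_subset[OF W'(3)]]) (use assms(4) in auto)
  then show ?thesis using smooth_near_on[OF _ o] assms(3) W'(2) by blast
qed

lemma smooth_near_chartI:
  assumes "(U, h) \<in> atlas M" "p \<in> U" "openin (mtop M) W" "p \<in> W" "W \<subseteq> U"
    "smooth_on (f \<circ> inv_into U h) (h ` W)"
  shows "smooth_near M p f"
  using smooth_fun_on_chart[OF assms(1,3,5,6)] assms(3,4) smooth_near_on by blast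

lemma smooth_near_const: "p \<in> points M \<Longrightarrow> smooth_near M p (\<lambda>q. c)"
  by (rule smooth_near_on[of "points M"]) (simp_all add: smooth_fun_on_def o_def smooth_on_const)

text \<open>
  Transfers a closure property of smooth functions on open sets of the coordinate space to germs
  on \<open>M\<close>.
\<close>

lemma smooth_near_op2:
  assumes "\<And>S (a::real^'n \<Rightarrow> real) b. open S \<Longrightarrow> smooth_on a S \<Longrightarrow> smooth_on b S \<Longrightarrow> smooth_on (\<lambda>x. F (a x) (b x)) S"
    and "smooth_near M p f" "smooth_near M p f'"
  shows "smooth_near M p (\<lambda>q. F (f q) (f' q))"
proof -
  obtain W where W: "openin (mtop M) W" "p \<in> W" "smooth_fun_on M W f"
    using assms(2) unfolding smooth_near_def by blast
  obtain W' where W': "openin (mtop M) W'" "p \<in> W'" "smooth_fun_on M W' f'"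
    using assms(3) unfolding smooth_near_def by blast
  have o: "openin (mtop M) (W \<inter> W')" using W W' by blast
  have "smooth_fun_on M (W \<inter> W') (\<lambda>q. F (f q) (f' q))"
    unfolding smooth_fun_on_def
  proof safe
    fix U h assume c: "(U, h) \<in> atlas M"
    show "smooth_on ((\<lambda>q. F (f q) (f' q)) \<circ> inv_into U h) (h ` (U \<inter> (W \<inter> W')))"
      using assms(1)[OF chart_image_open_Int[OF c o]
          smooth_fun_on_chartD[OF smooth_fun_on_subset[OF W(3)] c, of "W \<inter> W'"]
          smooth_fun_on_chartD[OF smooth_fun_on_subset[OF W'(3)] c, of "W \<inter> W'"]]
      by (simp add: o_def)
  qed
  then show ?thesis using smooth_near_on[OF _ o] W(2) W'(2) by blast
qed

lemma smooth_near_add: "smooth_near M p f \<Longrightarrow> smooth_near M p f' \<Longrightarrow> smooth_near M p (\<lambda>q. f q + f' q)"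
  using smooth_near_op2[of "(+)"] smooth_on_add by blast

lemma smooth_near_mult: "smooth_near M p f \<Longrightarrow> smooth_near M p f' \<Longrightarrow> smooth_near M p (\<lambda>q. f q * f' q)"
  using smooth_near_op2[of "(*)"] smooth_on_mult by blast

lemma smooth_near_points: "smooth_near M p f \<Longrightarrow> p \<in> points M"
  unfolding smooth_near_def using openin_subset by blast

lemma smooth_near_sum:
  "p \<in> points M \<Longrightarrow> (\<And>i. i \<in> I \<Longrightarrow> smooth_near M p (f i)) \<Longrightarrow> smooth_near M p (\<lambda>q. \<Sum>i\<in>I. f i q)"
  by (induction I rule: infinite_finite_induct) (auto intro: smooth_near_const smooth_near_add)

lemma smooth_near_uminus: "smooth_near M p f \<Longrightarrow> smooth_near M p (\<lambda>q. - f q)"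
  using smooth_near_mult[OF smooth_near_const[of p "-1"], of f] smooth_near_points by simp

lemma smooth_near_diff: "smooth_near M p f \<Longrightarrow> smooth_near M p f' \<Longrightarrow> smooth_near M p (\<lambda>q. f q - f' q)"
  using smooth_near_add[of p f, OF _ smooth_near_uminus] by simp

lemma smooth_near_nonzero:
  assumes "smooth_near M p f" "f p \<noteq> 0"
  obtains W where "openin (mtop M) W" "p \<in> W" "smooth_fun_on M W f" "\<And>q. q \<in> W \<Longrightarrow> f q \<noteq> 0"
    "smooth_fun_on M W (\<lambda>q. inverse (f q))"
proof -
  obtain U h where c: "(U, h) \<in> atlas M" "p \<in> U" using chart_at smooth_near_points[OF assms(1)] by blast
  obtain W where W: "openin (mtop M) W" "p \<in> W" "W \<subseteq> U" "smooth_fun_on M W f"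
    "smooth_on (f \<circ> inv_into U h) (h ` W)" "open (h ` W)"
    by (rule smooth_near_chart[OF assms(1) c])
  let ?F = "f \<circ> inv_into U h"
  have "continuous_on (h ` W) ?F"
    using W(5) unfolding smooth_on_def by (metis Ck_on.simps(1))
  then have o: "open (h ` W \<inter> ?F -` (- {0}))"
    using W(6) continuous_on_open_vimage[of "h ` W" ?F] by (simp add: Int_commute open_Compl)
  let ?W = "{q \<in> W. f q \<noteq> 0}"
  have im: "h ` ?W = h ` W \<inter> ?F -` (- {0})"
    using W(3) chart_inv[OF c(1)] by force
  have "openin (top_of_set (h ` U)) (h ` ?W)"
    using o im W(3) by (metis (no_types, lifting) image_mono le_inf_iff open_openin_trans openin_open_eq inf.cobounded1 order_trans chart_open c(1))
  then have "openin (subtopology (mtop M) U) ?W"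
    using homeomorphic_map_openness[OF chart_homeo[OF c(1)], of ?W] W(3) chart_subset[OF c(1)] by auto
  then have oW: "openin (mtop M) ?W"
    using chart_openin[OF c(1)] openin_trans_full by blast
  have s: "smooth_on ?F (h ` ?W)" by (rule smooth_on_subset[OF W(5)]) blast
  have "smooth_on (\<lambda>x. inverse (?F x)) (h ` ?W)"
    by (rule smooth_on_inverse[OF _ s]) (use o im in auto)
  then have "smooth_fun_on M ?W (\<lambda>q. inverse (f q))"
    by (intro smooth_fun_on_chart[OF c(1) oW]) (use W(3) in \<open>auto simp: o_def\<close>)
  moreover have "smooth_fun_on M ?W f" using W(4) by (rule smooth_fun_on_subset) blast
  ultimately show ?thesis using that[OF oW] W(2) assms(2) by blast
qed

text \<open>
  The tool for functions that are defined pointwise by the choice of a frame: if \<open>f\<close> is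
  a quotient of smooth functions near every point, with a numerator and a denominator that may depend on
  the point, then \<open>f\<close> is smooth.
\<close>

lemma smooth_fun_quotient:
  assumes "\<And>p. p \<in> points M \<Longrightarrow>
    \<exists>d n. smooth_fun M d \<and> smooth_fun M n \<and> d p \<noteq> 0 \<and> (\<forall>q\<in>points M. d q * f q = n q)"
  shows "smooth_fun M f"
proof (rule smooth_fun_on_if_near)
  fix p assume p: "p \<in> points M"
  from assms[OF p] obtain d n where dn: "smooth_fun M d" "smooth_fun M n" "d p \<noteq> 0"
    "\<And>q. q \<in> points M \<Longrightarrow> d q * f q = n q" by blast
  obtain W where W: "openin (mtop M) W" "p \<in> W" "\<And>q. q \<in> W \<Longrightarrow> d q \<noteq> 0"
    "smooth_fun_on M W (\<lambda>q. inverse (d q))"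
    using smooth_near_nonzero[OF smooth_near_smooth_fun[OF dn(1) p] dn(3)] by blast
  have "smooth_near M p (\<lambda>q. n q * inverse (d q))"
    by (intro smooth_near_mult smooth_near_smooth_fun[OF dn(2) p] smooth_near_on[OF W(4,1,2)])
  then show "smooth_near M p f"
  proof (rule smooth_near_cong[OF _ W(1,2)])
    fix q assume q: "q \<in> W"
    then have "q \<in> points M" using openin_subset[OF W(1)] by blast
    from dn(4)[OF this] W(3)[OF q] show "n q * inverse (d q) = f q" by (simp add: field_simps)
  qed
qed

lemma smooth_fun_on_coord:
  assumes "(U, h) \<in> atlas M"
  shows "smooth_fun_on M U (\<lambda>q. h q $ i)"
proof (rule smooth_fun_on_chart[OF assms chart_openin[OF assms] order_refl])
  have "smooth_on (\<lambda>x. x $ i) (h ` U)"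
    by (rule smooth_on_bounded_linear[OF bounded_linear_vec_nth chart_open[OF assms] smooth_on_ident])
  then show "smooth_on ((\<lambda>q. h q $ i) \<circ> inv_into U h) (h ` U)"
    by (rule smooth_on_cong[OF chart_open[OF assms]]) (use chart_inv[OF assms] in auto)
qed

lemma smooth_near_coord: "(U, h) \<in> atlas M \<Longrightarrow> p \<in> U \<Longrightarrow> smooth_near M p (\<lambda>q. h q $ i)"
  by (rule smooth_near_on[OF smooth_fun_on_coord chart_openin])


section \<open>Tangent vectors\<close>

lemma chart_has_derivative:
  assumes "smooth_near M p f" "(U, h) \<in> atlas M" "p \<in> U"
  shows "(f \<circ> inv_into U h has_derivative frechet_derivative (f \<circ> inv_into U h) (at (h p))) (at (h p))"
proof -
  obtain W where "openin (mtop M) W" and W: "p \<in> W" and "W \<subseteq> U" "smooth_fun_on M W f"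
    and s: "smooth_on (f \<circ> inv_into U h) (h ` W)" and "open (h ` W)"
    by (rule smooth_near_chart[OF assms])
  show ?thesis by (rule smooth_on_has_derivative[OF s]) (use W in blast)
qed

lemma chart_tangent_apply:
  "smooth_near M p f \<Longrightarrow>
    chart_tangent M (U, h) p v f = frechet_derivative (f \<circ> inv_into U h) (at (h p)) v"
  by (simp add: chart_tangent_def)

lemma chart_tangent_not_smooth: "\<not> smooth_near M p f \<Longrightarrow> chart_tangent M c p v f = 0"
  by (simp add: chart_tangent_def)

lemma chart_tangent_add:
  assumes "(U, h) \<in> atlas M" "p \<in> U"
  shows "chart_tangent M (U, h) p (v + w) = chart_tangent M (U, h) p v + chart_tangent M (U, h) p w"
  using linear_add[OF has_derivative_linear[OF chart_has_derivative[OF _ assms]]]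
  by (auto simp: chart_tangent_def fun_eq_iff)

lemma chart_tangent_scale:
  assumes "(U, h) \<in> atlas M" "p \<in> U"
  shows "chart_tangent M (U, h) p (a *\<^sub>R v) = scale_tangent a (chart_tangent M (U, h) p v)"
  using linear_scale[OF has_derivative_linear[OF chart_has_derivative[OF _ assms]]]
  by (auto simp: chart_tangent_def scale_tangent_def fun_eq_iff)

lemma chart_tangent_coord:
  assumes "(U, h) \<in> atlas M" "p \<in> U"
  shows "chart_tangent M (U, h) p v (\<lambda>q. h q $ i) = v $ i"
proof -
  have "((\<lambda>x. x $ i) has_derivative (\<lambda>v. v $ i)) (at (h p))"
    by (rule bounded_linear_imp_has_derivative[OF bounded_linear_vec_nth])
  then have "(((\<lambda>q. h q $ i) \<circ> inv_into U h) has_derivative (\<lambda>v. v $ i)) (at (h p))"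
    by (rule has_derivative_transform_within_open[OF _ chart_open[OF assms(1)]])
       (use assms chart_inv[OF assms(1)] in auto)
  then have "frechet_derivative ((\<lambda>q. h q $ i) \<circ> inv_into U h) (at (h p)) = (\<lambda>v. v $ i)"
    using frechet_derivative_at by metis
  then show ?thesis
    by (simp add: chart_tangent_apply[OF smooth_near_coord[OF assms]])
qed

text \<open>
  By the chain rule, tangent vectors built from one chart are tangent vectors of any other
  chart around the point. Therefore \<open>tangent_space M p\<close> is a vector space, isomorphic to the coordinate space.
\<close>

lemma chart_tangent_change:
  assumes "(U, h) \<in> atlas M" "p \<in> U" "(U', h') \<in> atlas M" "p \<in> U'"
  shows "chart_tangent M (U', h') p v =
    chart_tangent M (U, h) p (frechet_derivative (h \<circ> inv_into U' h') (at (h' p)) v)"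
proof
  fix f
  show "chart_tangent M (U', h') p v f =
    chart_tangent M (U, h) p (frechet_derivative (h \<circ> inv_into U' h') (at (h' p)) v) f"
  proof (cases "smooth_near M p f")
    case True
    let ?t = "h \<circ> inv_into U' h'" and ?F = "f \<circ> inv_into U h"
    have t: "(?t has_derivative frechet_derivative ?t (at (h' p))) (at (h' p))"
      by (rule smooth_on_has_derivative[OF transition[OF assms(3,1)]]) (use assms in auto)
    have tp: "?t (h' p) = h p" using chart_inv assms by auto
    have "(?F has_derivative frechet_derivative ?F (at (h p))) (at (?t (h' p)))"
      using chart_has_derivative[OF True assms(1,2)] tp by simp
    from has_derivative_compose[OF t this]
    have "((\<lambda>x. ?F (?t x)) has_derivative
        (\<lambda>v. frechet_derivative ?F (at (h p)) (frechet_derivative ?t (at (h' p)) v))) (at (h' p))" .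
    then have "((f \<circ> inv_into U' h') has_derivative
        (\<lambda>v. frechet_derivative ?F (at (h p)) (frechet_derivative ?t (at (h' p)) v))) (at (h' p))"
      by (rule has_derivative_transform_within_open[OF _ chart_image_open_Int[OF assms(3) chart_openin[OF assms(1)]]])
         (use assms chart_inv in auto)
    then have "frechet_derivative (f \<circ> inv_into U' h') (at (h' p)) =
        (\<lambda>v. frechet_derivative ?F (at (h p)) (frechet_derivative ?t (at (h' p)) v))"
      using frechet_derivative_at by metis
    then show ?thesis using True by (simp add: chart_tangent_apply)
  qed (simp add: chart_tangent_not_smooth)
qed

lemma tangent_space_chart:
  assumes "(U, h) \<in> atlas M" "p \<in> U"
  shows "tangent_space M p = range (chart_tangent M (U, h) p)"
proof
  show "tangent_space M p \<subseteq> range (chart_tangent M (U, h) p)"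
    unfolding tangent_space_def using chart_tangent_change[OF assms] by force
  show "range (chart_tangent M (U, h) p) \<subseteq> tangent_space M p"
    unfolding tangent_space_def using assms by force
qed

lemma tangent_coords:
  assumes "(U, h) \<in> atlas M" "p \<in> U" "u \<in> tangent_space M p"
  shows "u = chart_tangent M (U, h) p (\<chi> i. u (\<lambda>q. h q $ i))"
proof -
  obtain v where v: "u = chart_tangent M (U, h) p v"
    using assms(3) unfolding tangent_space_chart[OF assms(1,2)] by blast
  have "(\<chi> i. u (\<lambda>q. h q $ i)) = v" unfolding v by (simp add: vec_eq_iff chart_tangent_coord[OF assms(1,2)])
  then show ?thesis using v by simp
qed

lemma tangent_not_smooth: "u \<in> tangent_space M p \<Longrightarrow> \<not> smooth_near M p f \<Longrightarrow> u f = 0"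
  unfolding tangent_space_def by (auto simp: chart_tangent_not_smooth)

lemma tangent_add: "p \<in> points M \<Longrightarrow> u \<in> tangent_space M p \<Longrightarrow> v \<in> tangent_space M p \<Longrightarrow> u + v \<in> tangent_space M p"
  by (erule chart_at) (auto simp: tangent_space_chart chart_tangent_add[symmetric])

lemma tangent_scale: "p \<in> points M \<Longrightarrow> u \<in> tangent_space M p \<Longrightarrow> scale_tangent a u \<in> tangent_space M p"
  by (erule chart_at) (auto simp: tangent_space_chart chart_tangent_scale[symmetric])

lemma chart_tangent_in: "(U, h) \<in> atlas M \<Longrightarrow> p \<in> U \<Longrightarrow> chart_tangent M (U, h) p v \<in> tangent_space M p"
  by (simp add: tangent_space_chart)

lemma tangent_zero: "p \<in> points M \<Longrightarrow> 0 \<in> tangent_space M p"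
proof (erule chart_at)
  fix U h assume c: "(U, h) \<in> atlas M" "p \<in> U"
  have "scale_tangent 0 (chart_tangent M (U, h) p 0) = 0"
    by (simp add: scale_tangent_def fun_eq_iff)
  then show ?thesis
    using tangent_scale[OF _ chart_tangent_in[OF c], of 0 0] c chart_subset[OF c(1)] by auto
qed

lemma uminus_tangent: "- u = scale_tangent (-1) u"
  by (simp add: scale_tangent_def fun_eq_iff)

lemma tangent_uminus: "p \<in> points M \<Longrightarrow> u \<in> tangent_space M p \<Longrightarrow> - u \<in> tangent_space M p"
  by (simp add: uminus_tangent tangent_scale)

text \<open>
  Tangent vectors depend on germs only. Here \<open>f\<close> is arbitrary, because both sides vanish when \<open>f\<close>
  is not smooth near \<open>p\<close>.
\<close>

lemma tangent_local:
  assumes "u \<in> tangent_space M p" "openin (mtop M) W" "p \<in> W" "\<And>q. q \<in> W \<Longrightarrow> f q = f' q"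
  shows "u f = u f'"
proof (cases "smooth_near M p f")
  case True
  then have n': "smooth_near M p f'" by (rule smooth_near_cong[OF _ assms(2-4)])
  obtain U h v where c: "(U, h) \<in> atlas M" "p \<in> U" and u: "u = chart_tangent M (U, h) p v"
    using assms(1) unfolding tangent_space_def by auto
  have "((f' \<circ> inv_into U h) has_derivative frechet_derivative (f \<circ> inv_into U h) (at (h p))) (at (h p))"
    by (rule has_derivative_transform_within_open[OF chart_has_derivative[OF True c] chart_image_open_Int[OF c(1) assms(2)]])
       (use assms c chart_inv[OF c(1)] in auto)
  then have "frechet_derivative (f \<circ> inv_into U h) (at (h p)) = frechet_derivative (f' \<circ> inv_into U h) (at (h p))"
    by (rule frechet_derivative_at)
  then show ?thesis using True n' by (simp add: u chart_tangent_apply)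
next
  case False
  then have "\<not> smooth_near M p f'" using smooth_near_cong[of p f' W f] assms by metis
  with False show ?thesis by (simp add: tangent_not_smooth[OF assms(1)])
qed

lemma chart_tangent_eqI:
  assumes c: "(U, h) \<in> atlas M" "p \<in> U" and "smooth_near M p f"
    and "(f \<circ> inv_into U h has_derivative D) (at (h p))"
  shows "chart_tangent M (U, h) p v f = D v"
  using frechet_derivative_at[OF assms(4)] by (simp add: chart_tangent_apply[OF assms(3)])

lemma tangent_fun_add:
  assumes "u \<in> tangent_space M p" "smooth_near M p f" "smooth_near M p f'"
  shows "u (\<lambda>q. f q + f' q) = u f + u f'"
proof -
  obtain U h v where c: "(U, h) \<in> atlas M" "p \<in> U" and u: "u = chart_tangent M (U, h) p v"
    using assms(1) unfolding tangent_space_def by auto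
  show ?thesis unfolding u
    by (subst chart_tangent_eqI[OF c smooth_near_add[OF assms(2,3)]])
       (use has_derivative_add[OF chart_has_derivative[OF assms(2) c] chart_has_derivative[OF assms(3) c]]
         assms in \<open>auto simp: o_def chart_tangent_apply\<close>)
qed

lemma tangent_fun_mult:
  assumes "u \<in> tangent_space M p" "smooth_near M p f" "smooth_near M p f'"
  shows "u (\<lambda>q. f q * f' q) = f p * u f' + u f * f' p"
proof -
  obtain U h v where c: "(U, h) \<in> atlas M" "p \<in> U" and u: "u = chart_tangent M (U, h) p v"
    using assms(1) unfolding tangent_space_def by auto
  show ?thesis unfolding u
    by (subst chart_tangent_eqI[OF c smooth_near_mult[OF assms(2,3)]])
       (use has_derivative_mult[OF chart_has_derivative[OF assms(2) c] chart_has_derivative[OF assms(3) c]]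
         assms chart_inv[OF c] in \<open>auto simp: o_def chart_tangent_apply\<close>)
qed

lemma tangent_fun_const:
  assumes "p \<in> points M" "u \<in> tangent_space M p"
  shows "u (\<lambda>q. c) = 0"
proof -
  obtain U h v where c: "(U, h) \<in> atlas M" "p \<in> U" and u: "u = chart_tangent M (U, h) p v"
    using assms(2) unfolding tangent_space_def by auto
  show ?thesis unfolding u
    by (subst chart_tangent_eqI[OF c smooth_near_const[OF assms(1)], where D="\<lambda>v. 0"])
       (auto simp: o_def)
qed

lemma tangent_fun_uminus:
  assumes "u \<in> tangent_space M p" "smooth_near M p f"
  shows "u (\<lambda>q. - f q) = - u f"
  using tangent_fun_mult[OF assms(1) smooth_near_const assms(2), of "-1"]
    tangent_fun_const[OF _ assms(1), of "-1"] smooth_near_points[OF assms(2)] by simp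

lemma tangent_fun_diff:
  assumes "u \<in> tangent_space M p" "smooth_near M p f" "smooth_near M p f'"
  shows "u (\<lambda>q. f q - f' q) = u f - u f'"
  using tangent_fun_add[OF assms(1,2) smooth_near_uminus[OF assms(3)]]
    tangent_fun_uminus[OF assms(1,3)] by simp


section \<open>Vector fields\<close>

lemma vf_tangent: "vector_field M X \<Longrightarrow> p \<in> points M \<Longrightarrow> X p \<in> tangent_space M p"
  and vf_outside: "vector_field M X \<Longrightarrow> p \<notin> points M \<Longrightarrow> X p = 0"
  and vf_smooth: "vector_field M X \<Longrightarrow> (U, h) \<in> atlas M \<Longrightarrow> smooth_fun_on M U (\<lambda>p. X p (\<lambda>q. h q $ i))"
  unfolding vector_field_def by blast+

lemma vf_near: "vector_field M X \<Longrightarrow> (U, h) \<in> atlas M \<Longrightarrow> p \<in> U \<Longrightarrow> smooth_near M p (\<lambda>p. X p (\<lambda>q. h q $ i))"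
  by (rule smooth_near_on[OF vf_smooth chart_openin])

lemma vector_fieldI:
  assumes "\<And>p. p \<in> points M \<Longrightarrow> X p \<in> tangent_space M p" "\<And>p. p \<notin> points M \<Longrightarrow> X p = 0"
    "\<And>U h p i. (U, h) \<in> atlas M \<Longrightarrow> p \<in> U \<Longrightarrow> smooth_near M p (\<lambda>p. X p (\<lambda>q. h q $ i))"
  shows "vector_field M X"
  unfolding vector_field_def
proof (intro conjI ballI allI impI)
  fix c assume "c \<in> atlas M"
  then show "case c of (U, h) \<Rightarrow> \<forall>i. smooth_fun_on M U (\<lambda>p. X p (\<lambda>q. h q $ i))"
    using assms(3) smooth_fun_on_if_near by (cases c) simp
qed (use assms in auto)

lemma vf_add: "vector_field M X \<Longrightarrow> vector_field M Y \<Longrightarrow> vector_field M (X + Y)"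
  by (rule vector_fieldI) (auto simp: tangent_add vf_tangent vf_outside intro: smooth_near_add vf_near)

lemma scale_field_apply: "scale_field f X p k = f p * X p k"
  by (simp add: scale_field_def scale_tangent_def)

lemma vf_scale:
  assumes "smooth_fun M f" "vector_field M X"
  shows "vector_field M (scale_field f X)"
proof (rule vector_fieldI)
  fix p assume "p \<in> points M"
  then show "scale_field f X p \<in> tangent_space M p"
    unfolding scale_field_def using tangent_scale vf_tangent[OF assms(2)] by blast
next
  fix p assume "p \<notin> points M"
  then show "scale_field f X p = 0"
    by (simp add: fun_eq_iff scale_field_apply vf_outside[OF assms(2)])
next
  fix U h p i assume c: "(U, h) \<in> atlas M" "p \<in> U"
  then have "p \<in> points M" using chart_subset by blast
  then show "smooth_near M p (\<lambda>p. scale_field f X p (\<lambda>q. h q $ i))"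
    unfolding scale_field_apply
    by (rule smooth_near_mult[OF smooth_near_smooth_fun[OF assms(1)] vf_near[OF assms(2) c]])
qed

lemma vf_zero: "vector_field M 0"
  by (rule vector_fieldI) (use chart_subset in \<open>auto simp: tangent_zero intro!: smooth_near_const\<close>)

lemma vf_uminus: "vector_field M X \<Longrightarrow> vector_field M (- X)"
  by (rule vector_fieldI) (auto simp: tangent_uminus vf_tangent vf_outside intro: smooth_near_uminus vf_near)

lemma vf_diff: "vector_field M X \<Longrightarrow> vector_field M Y \<Longrightarrow> vector_field M (X - Y)"
  using vf_add[of X "- Y"] vf_uminus by simp

text \<open>
  Near \<open>p\<close>, the function \<open>X f\<close> is the sum of the products of the components of \<open>X\<close> with the partial
  derivatives of \<open>f\<close> in a chart.
\<close>

lemma vf_apply_near: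
  assumes X: "vector_field M X" and f: "smooth_near M p f"
  shows "smooth_near M p (\<lambda>q. X q f)"
proof -
  obtain U h where c: "(U, h) \<in> atlas M" "p \<in> U" using chart_at smooth_near_points[OF f] by blast
  let ?F = "f \<circ> inv_into U h"
  obtain W where W: "openin (mtop M) W" "p \<in> W" "W \<subseteq> U" "smooth_fun_on M W f"
    "smooth_on ?F (h ` W)" "open (h ` W)"
    by (rule smooth_near_chart[OF f c])
  have s: "smooth_near M p (\<lambda>q. frechet_derivative ?F (at (h q)) e)" for e
  proof (rule smooth_near_chartI[OF c W(1-3)])
    show "smooth_on ((\<lambda>q. frechet_derivative ?F (at (h q)) e) \<circ> inv_into U h) (h ` W)"
      by (rule smooth_on_cong[OF W(6) smooth_on_frechet_derivative[OF W(5), of e]])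
         (use W(3) chart_inv[OF c(1)] in \<open>auto simp: subset_eq\<close>)
  qed
  have "smooth_near M p (\<lambda>q. \<Sum>i\<in>UNIV. X q (\<lambda>q. h q $ i) * frechet_derivative ?F (at (h q)) (axis i 1))"
    by (intro smooth_near_sum smooth_near_mult s vf_near[OF X c] smooth_near_points[OF f])
  then show ?thesis
  proof (rule smooth_near_cong[OF _ W(1,2)])
    fix q assume q: "q \<in> W"
    then have qU: "q \<in> U" and qp: "q \<in> points M" using W(3) chart_subset[OF c(1)] by auto
    have n: "smooth_near M q f" using smooth_near_on[OF W(4,1) q] .
    let ?v = "\<chi> i. X q (\<lambda>q. h q $ i)"
    have l: "linear (frechet_derivative ?F (at (h q)))"
      by (rule has_derivative_linear[OF chart_has_derivative[OF n c(1) qU]])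
    have "X q f = frechet_derivative ?F (at (h q)) ?v"
      using tangent_coords[OF c(1) qU vf_tangent[OF X qp]] chart_tangent_apply[OF n] by metis
    also have "?v = (\<Sum>i\<in>UNIV. X q (\<lambda>q. h q $ i) *\<^sub>R axis i 1)"
      by (simp add: vec_eq_iff axis_def if_distrib cong: if_cong)
    also have "frechet_derivative ?F (at (h q)) \<dots> =
        (\<Sum>i\<in>UNIV. X q (\<lambda>q. h q $ i) * frechet_derivative ?F (at (h q)) (axis i 1))"
      by (simp add: linear_sum[OF l] linear_scale[OF l])
    finally show "(\<Sum>i\<in>UNIV. X q (\<lambda>q. h q $ i) * frechet_derivative ?F (at (h q)) (axis i 1)) = X q f" ..
  qed
qed

lemma vf_apply_smooth: "vector_field M X \<Longrightarrow> smooth_fun M f \<Longrightarrow> smooth_fun M (\<lambda>q. X q f)"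
  by (rule smooth_fun_on_if_near) (blast intro: vf_apply_near smooth_near_smooth_fun)

lemma lie_bracket_apply:
  "smooth_near M p k \<Longrightarrow> lie_bracket M X Y p k = X p (\<lambda>q. Y q k) - Y p (\<lambda>q. X q k)"
  by (simp add: lie_bracket_def)

text \<open>
  The bracket \<open>[Y,Z] k\<close> equals \<open>YZ k - ZY k\<close> only where \<open>k\<close> is smooth, so locality of \<open>X p\<close> is needed to
  differentiate it term by term.
\<close>

lemma lie_bracket_twice:
  assumes "vector_field M X" "vector_field M Y" "vector_field M Z" "smooth_near M p k"
  shows "X p (\<lambda>q. lie_bracket M Y Z q k) = X p (\<lambda>q. Y q (\<lambda>r. Z r k)) - X p (\<lambda>q. Z q (\<lambda>r. Y r k))"
proof -
  obtain W where W: "openin (mtop M) W" "p \<in> W" "smooth_fun_on M W k"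
    using assms(4) unfolding smooth_near_def by blast
  have p: "p \<in> points M" using smooth_near_points[OF assms(4)] .
  have "X p (\<lambda>q. lie_bracket M Y Z q k) = X p (\<lambda>q. Y q (\<lambda>r. Z r k) - Z q (\<lambda>r. Y r k))"
    by (rule tangent_local[OF vf_tangent[OF assms(1) p] W(1,2)])
       (simp add: lie_bracket_apply smooth_near_on[OF W(3,1)])
  also have "\<dots> = X p (\<lambda>q. Y q (\<lambda>r. Z r k)) - X p (\<lambda>q. Z q (\<lambda>r. Y r k))"
    by (rule tangent_fun_diff[OF vf_tangent[OF assms(1) p]
          vf_apply_near[OF assms(2) vf_apply_near[OF assms(3,4)]]
          vf_apply_near[OF assms(3) vf_apply_near[OF assms(2,4)]]])
  finally show ?thesis .
qed

lemma jacobi: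
  assumes "vector_field M X" "vector_field M Y" "vector_field M Z"
  shows "lie_bracket M X (lie_bracket M Y Z) + lie_bracket M Y (lie_bracket M Z X)
    + lie_bracket M Z (lie_bracket M X Y) = 0"
proof (intro ext)
  fix p k
  show "(lie_bracket M X (lie_bracket M Y Z) + lie_bracket M Y (lie_bracket M Z X)
    + lie_bracket M Z (lie_bracket M X Y)) p k = 0 p k"
  proof (cases "smooth_near M p k")
    case True
    have n: "smooth_near M p (\<lambda>q. A q k)" if "vector_field M A" for A
      by (rule vf_apply_near[OF that True])
    show ?thesis
      using True n assms by (simp add: lie_bracket_apply lie_bracket_twice)
  qed (simp add: lie_bracket_def)
qed

text \<open>
  A coordinate field is multiplied by a bump function whose support is the preimage \<open>K\<close> of a closed ball
  in the coordinate domain. The Hausdorff property makes the compact set \<open>K\<close> closed in \<open>M\<close>, so that the extension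
  by \<open>0\<close> is smooth outside \<open>U\<close> as well.
\<close>

lemma vector_field_extension:
  assumes "p \<in> points M" "u \<in> tangent_space M p"
  obtains X where "vector_field M X" "X p = u"
proof -
  obtain U h v where c: "(U, h) \<in> atlas M" "p \<in> U" and u: "u = chart_tangent M (U, h) p v"
    using assms(2) unfolding tangent_space_def by auto
  obtain r where r: "r > 0" "cball (h p) r \<subseteq> h ` U"
    using open_contains_cball_eq[OF chart_open[OF c(1)]] c(2) by blast
  obtain b :: "real ^ 'n \<Rightarrow> real" where b: "smooth_on b UNIV" "b (h p) = 1" "\<forall>x. x \<notin> ball (h p) r \<longrightarrow> b x = 0"
    using bump_exists[OF r(1), of "h p"] by blast
  define K where "K = {q \<in> U. h q \<in> cball (h p) r}"
  have hK: "h ` K = cball (h p) r" using r(2) unfolding K_def by auto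
  have "compactin (top_of_set (h ` U)) (h ` K)"
    unfolding hK using r(2) by (simp add: compactin_subtopology)
  then have "compactin (subtopology (mtop M) U) K"
    using homeomorphic_map_compactness[OF chart_homeo[OF c(1)], of K] chart_subset[OF c(1)]
    unfolding K_def by auto
  then have "compactin (mtop M) K" by (simp add: compactin_subtopology)
  then have "closedin (mtop M) K" by (rule compactin_imp_closedin[OF Hausdorff])
  then have oK: "openin (mtop M) (points M - K)" by blast
  define X where "X = (\<lambda>q. if q \<in> U then scale_tangent (b (h q)) (chart_tangent M (U, h) q v) else 0)"
  have X0: "X q = 0" if "q \<notin> K" for q
    using that b(3)[rule_format, of "h q"] by (auto simp: X_def K_def scale_tangent_def fun_eq_iff)
  have "vector_field M X"
  proof (rule vector_fieldI)
    fix q assume "q \<in> points M"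
    then show "X q \<in> tangent_space M q"
      by (auto simp: X_def intro!: tangent_scale tangent_zero chart_tangent_in[OF c(1)])
  next
    fix q assume "q \<notin> points M"
    then show "X q = 0" using chart_subset[OF c(1)] by (auto simp: X_def)
  next
    fix U' h' q i assume c': "(U', h') \<in> atlas M" "q \<in> U'"
    then have qp: "q \<in> points M" using chart_subset by blast
    show "smooth_near M q (\<lambda>p. X p (\<lambda>q. h' q $ i))"
    proof (cases "q \<in> U")
      case False
      have 0: "smooth_near M q (\<lambda>p. 0)" by (rule smooth_near_const[OF qp])
      show ?thesis
        by (rule smooth_near_cong[OF 0 oK]) (use False qp X0 in \<open>auto simp: K_def\<close>)
    next
      case True
      let ?W = "U \<inter> U'" and ?F = "(\<lambda>q. h' q $ i) \<circ> inv_into U h"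
      have oW: "openin (mtop M) ?W" using c c' chart_openin by blast
      have o: "open (h ` ?W)" by (rule chart_image_open[OF c(1) oW]) blast
      have sF: "smooth_on ?F (h ` ?W)"
        by (rule smooth_fun_on_chartD[OF smooth_fun_on_coord[OF c'(1)] c(1)])
      have "smooth_on (\<lambda>x. b x * frechet_derivative ?F (at x) v) (h ` ?W)"
        by (intro smooth_on_mult o smooth_on_frechet_derivative sF smooth_on_subset[OF b(1)]) simp
      then have "smooth_on ((\<lambda>p. X p (\<lambda>q. h' q $ i)) \<circ> inv_into U h) (h ` ?W)"
      proof (rule smooth_on_cong[OF o])
        fix x assume "x \<in> h ` ?W"
        then obtain q where q: "q \<in> U" "q \<in> U'" "x = h q" by blast
        show "b x * frechet_derivative ?F (at x) v = ((\<lambda>p. X p (\<lambda>q. h' q $ i)) \<circ> inv_into U h) x"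
          using q chart_inv[OF c(1)] smooth_near_coord[OF c'(1) q(2), of i]
          by (simp add: X_def scale_tangent_def chart_tangent_apply)
      qed
      then show ?thesis
        by (intro smooth_near_chartI[OF c(1) True oW]) (use c' True in auto)
    qed
  qed
  moreover have "X p = u" using c(2) b(2) by (simp add: X_def u scale_tangent_def)
  ultimately show ?thesis using that by blast
qed

end

section \<open>The calculus of vector fields and functions\<close>

text \<open>
  The derivative of \<open>f\<close> along \<open>X\<close>. It has a name of its own so that linearity and the Leibniz rule can be
  used as rewrite rules.
\<close>

definition dir :: "'a vfield \<Rightarrow> ('a \<Rightarrow> real) \<Rightarrow> 'a \<Rightarrow> real" where
  "dir X f p = X p f"

context smooth_mfd
begin

abbreviation vf :: "'a vfield \<Rightarrow> bool" where "vf \<equiv> vector_field M"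
abbreviation sf :: "('a \<Rightarrow> real) \<Rightarrow> bool" where "sf \<equiv> smooth_fun M"

declare vf_add [simp] vf_diff [simp] vf_uminus [simp] vf_scale [simp] vf_zero [simp]

lemma sf_const [simp]: "sf (\<lambda>p. c)"
  by (rule smooth_fun_on_if_near) (rule smooth_near_const)

lemma sf_add [simp]: "sf f \<Longrightarrow> sf f' \<Longrightarrow> sf (\<lambda>p. f p + f' p)"
  by (rule smooth_fun_on_if_near) (intro smooth_near_add smooth_near_smooth_fun)

lemma sf_diff [simp]: "sf f \<Longrightarrow> sf f' \<Longrightarrow> sf (\<lambda>p. f p - f' p)"
  by (rule smooth_fun_on_if_near) (intro smooth_near_diff smooth_near_smooth_fun)

lemma sf_uminus [simp]: "sf f \<Longrightarrow> sf (\<lambda>p. - f p)"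
  by (rule smooth_fun_on_if_near) (intro smooth_near_uminus smooth_near_smooth_fun)

lemma sf_mult [simp]: "sf f \<Longrightarrow> sf f' \<Longrightarrow> sf (\<lambda>p. f p * f' p)"
  by (rule smooth_fun_on_if_near) (intro smooth_near_mult smooth_near_smooth_fun)

lemma sf_divide [simp]: "sf f \<Longrightarrow> sf (\<lambda>p. f p / a)"
  unfolding divide_inverse by simp

lemma sf_dir [simp]: "vf X \<Longrightarrow> sf f \<Longrightarrow> sf (dir X f)"
  unfolding dir_def[abs_def] by (rule vf_apply_smooth)

text \<open>
  Identities between functions hold on \<open>M\<close> only; the values outside \<open>M\<close> are irrelevant for
  differentiation.
\<close>

lemma dir_cong:
  "vf X \<Longrightarrow> p \<in> points M \<Longrightarrow> (\<And>q. q \<in> points M \<Longrightarrow> f q = f' q) \<Longrightarrow> dir X f p = dir X f' p"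
  unfolding dir_def by (rule tangent_local[OF vf_tangent]) auto

lemma dir_const [simp]: "vf X \<Longrightarrow> p \<in> points M \<Longrightarrow> dir X (\<lambda>q. c) p = 0"
  unfolding dir_def by (rule tangent_fun_const[OF _ vf_tangent])

lemma dir_add [simp]:
  "vf X \<Longrightarrow> p \<in> points M \<Longrightarrow> sf f \<Longrightarrow> sf f' \<Longrightarrow> dir X (\<lambda>q. f q + f' q) p = dir X f p + dir X f' p"
  unfolding dir_def by (rule tangent_fun_add[OF vf_tangent]) (auto intro: smooth_near_smooth_fun)

lemma dir_diff [simp]:
  "vf X \<Longrightarrow> p \<in> points M \<Longrightarrow> sf f \<Longrightarrow> sf f' \<Longrightarrow> dir X (\<lambda>q. f q - f' q) p = dir X f p - dir X f' p"
  unfolding dir_def by (rule tangent_fun_diff[OF vf_tangent]) (auto intro: smooth_near_smooth_fun)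

lemma dir_uminus [simp]:
  "vf X \<Longrightarrow> p \<in> points M \<Longrightarrow> sf f \<Longrightarrow> dir X (\<lambda>q. - f q) p = - dir X f p"
  unfolding dir_def by (rule tangent_fun_uminus[OF vf_tangent]) (auto intro: smooth_near_smooth_fun)

lemma dir_mult [simp]:
  "vf X \<Longrightarrow> p \<in> points M \<Longrightarrow> sf f \<Longrightarrow> sf f' \<Longrightarrow>
    dir X (\<lambda>q. f q * f' q) p = f p * dir X f' p + dir X f p * f' p"
  unfolding dir_def by (rule tangent_fun_mult[OF vf_tangent]) (auto intro: smooth_near_smooth_fun)

lemma dir_divide [simp]: "vf X \<Longrightarrow> p \<in> points M \<Longrightarrow> sf f \<Longrightarrow> dir X (\<lambda>q. f q / a) p = dir X f p / a"
  unfolding divide_inverse by simp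

lemma dir_field [simp]:
  "dir (X + Y) f p = dir X f p + dir Y f p"
  "dir (X - Y) f p = dir X f p - dir Y f p"
  "dir (- X) f p = - dir X f p"
  "dir 0 f p = 0"
  "dir (scale_field a X) f p = a p * dir X f p"
  by (simp_all add: dir_def scale_field_apply)

lemma dir_lie_bracket:
  "p \<in> points M \<Longrightarrow> sf f \<Longrightarrow> dir (lie_bracket M X Y) f p = dir X (dir Y f) p - dir Y (dir X f) p"
  unfolding dir_def by (rule lie_bracket_apply[OF smooth_near_smooth_fun])

end

section \<open>The Levi-Civita connection and its curvature\<close>

locale levi_civita_mfd = smooth_mfd M for M :: "('a, 'n::finite) manifold" +
  fixes g :: "'a \<Rightarrow> 'a tangent \<Rightarrow> 'a tangent \<Rightarrow> real"
    and nabla :: "'a vfield \<Rightarrow> 'a vfield \<Rightarrow> 'a vfield"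
  assumes metric: "pseudo_riemannian_metric M g"
    and levi_civita: "levi_civita M g nabla"
begin

definition ip :: "'a vfield \<Rightarrow> 'a vfield \<Rightarrow> 'a \<Rightarrow> real" where
  "ip X Y p = g p (X p) (Y p)"

lemma sf_ip [simp]: "vf X \<Longrightarrow> vf Y \<Longrightarrow> sf (ip X Y)"
  using conjunct2[OF metric[unfolded pseudo_riemannian_metric_def]] by (simp add: ip_def[abs_def])

lemma g_sym: "p \<in> points M \<Longrightarrow> u \<in> tangent_space M p \<Longrightarrow> v \<in> tangent_space M p \<Longrightarrow> g p u v = g p v u"
  and g_add: "p \<in> points M \<Longrightarrow> u \<in> tangent_space M p \<Longrightarrow> v \<in> tangent_space M p \<Longrightarrow>
    w \<in> tangent_space M p \<Longrightarrow> g p (u + v) w = g p u w + g p v w"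
  and g_scale: "p \<in> points M \<Longrightarrow> u \<in> tangent_space M p \<Longrightarrow> w \<in> tangent_space M p \<Longrightarrow>
    g p (scale_tangent a u) w = a * g p u w"
  and g_nondegenerate: "p \<in> points M \<Longrightarrow> u \<in> tangent_space M p \<Longrightarrow>
    (\<And>v. v \<in> tangent_space M p \<Longrightarrow> g p u v = 0) \<Longrightarrow> u = 0"
  using metric unfolding pseudo_riemannian_metric_def by blast+

lemma ip_sym: "vf X \<Longrightarrow> vf Y \<Longrightarrow> p \<in> points M \<Longrightarrow> ip X Y p = ip Y X p"
  unfolding ip_def by (simp add: g_sym vf_tangent)

lemma ip_add_left [simp]:
  "vf X \<Longrightarrow> vf Y \<Longrightarrow> vf Z \<Longrightarrow> p \<in> points M \<Longrightarrow> ip (X + Y) Z p = ip X Z p + ip Y Z p"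
  unfolding ip_def by (simp add: g_add vf_tangent)

lemma ip_scale_left [simp]:
  "vf X \<Longrightarrow> vf Z \<Longrightarrow> p \<in> points M \<Longrightarrow> ip (scale_field f X) Z p = f p * ip X Z p"
  unfolding ip_def scale_field_def by (simp add: g_scale vf_tangent)

lemma uminus_field: "- X = scale_field (\<lambda>p. - 1) X"
  by (simp add: fun_eq_iff scale_field_apply)

lemma diff_field: "X - Y = X + scale_field (\<lambda>p. - 1) Y" for X Y :: "'a vfield"
  by (simp add: fun_eq_iff scale_field_apply)

lemma ip_uminus_left [simp]: "vf X \<Longrightarrow> vf Z \<Longrightarrow> p \<in> points M \<Longrightarrow> ip (- X) Z p = - ip X Z p"
  by (simp add: uminus_field del: vf_uminus)

lemma ip_diff_left [simp]:
  "vf X \<Longrightarrow> vf Y \<Longrightarrow> vf Z \<Longrightarrow> p \<in> points M \<Longrightarrow> ip (X - Y) Z p = ip X Z p - ip Y Z p"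
  by (simp add: diff_field)

lemma ip_zero_left [simp]: "vf Z \<Longrightarrow> p \<in> points M \<Longrightarrow> ip 0 Z p = 0"
  using ip_add_left[of 0 0 Z p] by simp

lemma ip_right [simp]:
  assumes "p \<in> points M" "vf Z"
  shows "vf X \<Longrightarrow> vf Y \<Longrightarrow> ip Z (X + Y) p = ip Z X p + ip Z Y p"
    and "vf X \<Longrightarrow> vf Y \<Longrightarrow> ip Z (X - Y) p = ip Z X p - ip Z Y p"
    and "vf X \<Longrightarrow> ip Z (- X) p = - ip Z X p"
    and "ip Z 0 p = 0"
    and "vf X \<Longrightarrow> sf f \<Longrightarrow> ip Z (scale_field f X) p = f p * ip Z X p"
  using assms by (simp_all add: ip_sym[of Z])

text \<open>
  Non-degeneracy of the metric, tested on global fields. Vector identities are proved in this way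
  by real arithmetic.
\<close>

lemma vf_eqI_at:
  assumes "vf X" "vf Y" "p \<in> points M" "\<And>Z. vf Z \<Longrightarrow> ip X Z p = ip Y Z p"
  shows "X p = Y p"
proof -
  have "(X - Y) p = 0"
  proof (rule g_nondegenerate[OF assms(3)])
    fix v assume v: "v \<in> tangent_space M p"
    obtain Z where Z: "vf Z" "Z p = v" using vector_field_extension[OF assms(3) v] .
    show "g p ((X - Y) p) v = 0"
      using ip_diff_left[OF assms(1,2) Z(1) assms(3)] assms(4)[OF Z(1)] Z(2) unfolding ip_def by simp
  qed (use assms vf_tangent[of "X - Y"] in simp)
  then show ?thesis by simp
qed

lemma vf_eqI:
  assumes "vf X" "vf Y" "\<And>p Z. p \<in> points M \<Longrightarrow> vf Z \<Longrightarrow> ip X Z p = ip Y Z p"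
  shows "X = Y"
proof
  fix p show "X p = Y p"
    using vf_eqI_at[OF assms(1,2)] assms vf_outside by (cases "p \<in> points M") auto
qed

lemma affine: "affine_connection M nabla"
  and torsion_free: "vf X \<Longrightarrow> vf Y \<Longrightarrow> lie_bracket M X Y = nabla X Y - nabla Y X"
  and dir_ip [simp]: "vf X \<Longrightarrow> vf Y \<Longrightarrow> vf Z \<Longrightarrow> p \<in> points M \<Longrightarrow>
    dir X (ip Y Z) p = ip (nabla X Y) Z p + ip Y (nabla X Z) p"
  using levi_civita unfolding levi_civita_def dir_def ip_def by auto

lemma nabla_vf [simp]: "vf X \<Longrightarrow> vf Y \<Longrightarrow> vf (nabla X Y)"
  and nabla_add_left [simp]: "vf X \<Longrightarrow> vf Y \<Longrightarrow> vf Z \<Longrightarrow> nabla (X + Y) Z = nabla X Z + nabla Y Z"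
  and nabla_add_right [simp]: "vf X \<Longrightarrow> vf Y \<Longrightarrow> vf Z \<Longrightarrow> nabla X (Y + Z) = nabla X Y + nabla X Z"
  and nabla_scale_left [simp]: "sf f \<Longrightarrow> vf X \<Longrightarrow> vf Y \<Longrightarrow> nabla (scale_field f X) Y = scale_field f (nabla X Y)"
  using affine unfolding affine_connection_def by simp_all

lemma nabla_scale_right [simp]: "sf f \<Longrightarrow> vf X \<Longrightarrow> vf Y \<Longrightarrow>
    nabla X (scale_field f Y) = scale_field (dir X f) Y + scale_field f (nabla X Y)"
proof -
  have "dir X f = (\<lambda>p. X p f)" by (simp add: dir_def fun_eq_iff)
  then show "sf f \<Longrightarrow> vf X \<Longrightarrow> vf Y \<Longrightarrow>
    nabla X (scale_field f Y) = scale_field (dir X f) Y + scale_field f (nabla X Y)"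
    using affine unfolding affine_connection_def by simp
qed

lemma nabla_uminus_left [simp]: "vf X \<Longrightarrow> vf Y \<Longrightarrow> nabla (- X) Y = - nabla X Y"
  by (simp add: uminus_field del: vf_uminus)

lemma nabla_diff_left [simp]: "vf X \<Longrightarrow> vf Y \<Longrightarrow> vf Z \<Longrightarrow> nabla (X - Y) Z = nabla X Z - nabla Y Z"
  by (simp add: diff_field)

lemma nabla_zero_right [simp]: "vf X \<Longrightarrow> nabla X 0 = 0"
  using nabla_add_right[of X 0 0] by simp

lemma nabla_zero_left [simp]: "vf X \<Longrightarrow> nabla 0 X = 0"
  using nabla_add_left[of 0 0 X] by simp

lemma nabla_uminus_right [simp]: "vf X \<Longrightarrow> vf Y \<Longrightarrow> nabla X (- Y) = - nabla X Y"
  using nabla_add_right[of X Y "- Y"] by (simp add: eq_neg_iff_add_eq_0 add.commute)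

lemma nabla_diff_right [simp]: "vf X \<Longrightarrow> vf Y \<Longrightarrow> vf Z \<Longrightarrow> nabla X (Y - Z) = nabla X Y - nabla X Z"
  using nabla_add_right[of X Y "- Z"] by simp

lemma lie_vf [simp]: "vf X \<Longrightarrow> vf Y \<Longrightarrow> vf (lie_bracket M X Y)"
  by (simp add: torsion_free)

lemma curvature_eq:
  "vf X \<Longrightarrow> vf Y \<Longrightarrow> vf Z \<Longrightarrow> curvature M nabla X Y Z =
    nabla X (nabla Y Z) - nabla Y (nabla X Z) - nabla (nabla X Y) Z + nabla (nabla Y X) Z"
  by (simp add: curvature_def torsion_free)

lemma curvature_vf [simp]: "vf X \<Longrightarrow> vf Y \<Longrightarrow> vf Z \<Longrightarrow> vf (curvature M nabla X Y Z)"
  by (simp add: curvature_eq)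

lemma dir_commute:
  assumes "vf X" "vf Y" "sf f" "p \<in> points M"
  shows "dir X (dir Y f) p - dir Y (dir X f) p = dir (nabla X Y) f p - dir (nabla Y X) f p"
  using dir_lie_bracket[OF assms(4,3), of X Y] by (simp add: torsion_free assms)

definition riemann :: "'a vfield \<Rightarrow> 'a vfield \<Rightarrow> 'a vfield \<Rightarrow> 'a vfield \<Rightarrow> 'a \<Rightarrow> real" where
  "riemann X Y Z W p = ip (curvature M nabla X Y Z) W p"

lemma curvature_skew: "vf X \<Longrightarrow> vf Y \<Longrightarrow> vf Z \<Longrightarrow> curvature M nabla X Y Z = - curvature M nabla Y X Z"
  by (simp add: curvature_eq)

lemma riemann_skew1: "vf X \<Longrightarrow> vf Y \<Longrightarrow> vf Z \<Longrightarrow> vf W \<Longrightarrow> p \<in> points M \<Longrightarrow> riemann X Y Z W p = - riemann Y X Z W p"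
  unfolding riemann_def using curvature_skew[of X Y Z] by simp

text \<open>
  For a torsion-free connection the cyclic sum of \<open>R(X,Y)Z\<close> reduces to the Jacobi identity.
\<close>

lemma bianchi1:
  assumes [simp]: "vf X" "vf Y" "vf Z"
  shows "curvature M nabla X Y Z + curvature M nabla Y Z X + curvature M nabla Z X Y = 0"
proof -
  have "lie_bracket M X (lie_bracket M Y Z) + lie_bracket M Y (lie_bracket M Z X)
    + lie_bracket M Z (lie_bracket M X Y) = 0" by (rule jacobi) simp_all
  then show ?thesis by (simp add: torsion_free curvature_eq algebra_simps)
qed

lemma riemann_bianchi1:
  assumes [simp]: "vf X" "vf Y" "vf Z" "vf W" "p \<in> points M"
  shows "riemann X Y Z W p + riemann Y Z X W p + riemann Z X Y W p = 0"
proof -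
  have "ip (curvature M nabla X Y Z + curvature M nabla Y Z X + curvature M nabla Z X Y) W p = 0"
    by (simp only: bianchi1[OF assms(1-3)]) simp
  then show ?thesis by (simp add: riemann_def)
qed

lemma dir_dir_ip:
  assumes [simp]: "vf X" "vf Y" "vf Z" "vf W" "p \<in> points M"
  shows "dir X (dir Y (ip Z W)) p = ip (nabla X (nabla Y Z)) W p + ip (nabla Y Z) (nabla X W) p
    + ip (nabla X Z) (nabla Y W) p + ip Z (nabla X (nabla Y W)) p"
proof -
  have "dir X (dir Y (ip Z W)) p = dir X (\<lambda>q. ip (nabla Y Z) W q + ip Z (nabla Y W) q) p"
    by (rule dir_cong) (simp_all add: dir_ip)
  then show ?thesis by (simp add: dir_ip)
qed

text \<open>
  Since \<open>\<nabla>\<close> is metric, this is the statement that \<open>[X,Y]\<close> acts on the function \<open>\<langle>Z,W\<rangle>\<close> as a commutator.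
\<close>

lemma riemann_skew2:
  assumes [simp]: "vf X" "vf Y" "vf Z" "vf W" "p \<in> points M"
  shows "riemann X Y Z W p = - riemann X Y W Z p"
  using dir_commute[of X Y "ip Z W" p]
  by (simp add: dir_dir_ip dir_ip riemann_def curvature_eq ip_sym[of Z])

text \<open>
  The sum of the first two of these four instances of the Bianchi identity, minus the sum of the other two, is
  twice the claim once skew symmetry is applied to each term.
\<close>

lemma riemann_pair_sym:
  assumes "vf X" "vf Y" "vf Z" "vf W" "p \<in> points M"
  shows "riemann X Y Z W p = riemann Z W X Y p"
  using riemann_bianchi1[OF assms(1,2,3,4,5)] riemann_bianchi1[OF assms(2,3,4,1,5)] riemann_bianchi1[OF assms(3,4,1,2,5)] riemann_bianchi1[OF assms(4,1,2,3,5)]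
    riemann_skew2[OF assms(1,2,3,4,5)]
    riemann_skew2[OF assms(2,3,1,4,5)]
    riemann_skew2[OF assms(1,3,2,4,5)]
    riemann_skew2[OF assms(3,4,2,1,5)]
    riemann_skew2[OF assms(2,4,3,1,5)]
    riemann_skew2[OF assms(4,1,3,2,5)]
    riemann_skew1[OF assms(3,1,2,4,5)] riemann_skew1[OF assms(4,2,3,1,5)]
  by linarith

lemma curvature_add:
  assumes [simp]: "vf X" "vf X'" "vf Y" "vf Z"
  shows "curvature M nabla (X + X') Y Z = curvature M nabla X Y Z + curvature M nabla X' Y Z"
  by (simp add: curvature_eq algebra_simps)

lemma curvature_scale:
  assumes [simp]: "sf f" "vf X" "vf Y" "vf Z"
  shows "curvature M nabla (scale_field f X) Y Z = scale_field f (curvature M nabla X Y Z)"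
  by (simp add: curvature_eq fun_eq_iff scale_field_apply algebra_simps)

lemma riemann_add: "vf X \<Longrightarrow> vf X' \<Longrightarrow> vf Y \<Longrightarrow> vf Z \<Longrightarrow> vf W \<Longrightarrow> p \<in> points M \<Longrightarrow>
    riemann (X + X') Y Z W p = riemann X Y Z W p + riemann X' Y Z W p"
  by (simp add: riemann_def curvature_add)

lemma riemann_scale: "sf f \<Longrightarrow> vf X \<Longrightarrow> vf Y \<Longrightarrow> vf Z \<Longrightarrow> vf W \<Longrightarrow> p \<in> points M \<Longrightarrow>
    riemann (scale_field f X) Y Z W p = f p * riemann X Y Z W p"
  by (simp add: riemann_def curvature_scale)

text \<open>
  The second Bianchi identity as an operator identity: it is the Jacobi identity for commutators of
  \<open>\<nabla>\<^sub>X\<close>, \<open>\<nabla>\<^sub>Y\<close>, \<open>\<nabla>\<^sub>Z\<close> combined with the one for vector fields.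
\<close>

lemma bianchi2:
  assumes [simp]: "vf X" "vf Y" "vf Z" "vf U"
  shows "nabla X (curvature M nabla Y Z U) - curvature M nabla Y Z (nabla X U)
      + curvature M nabla X (lie_bracket M Y Z) U
    + (nabla Y (curvature M nabla Z X U) - curvature M nabla Z X (nabla Y U)
      + curvature M nabla Y (lie_bracket M Z X) U)
    + (nabla Z (curvature M nabla X Y U) - curvature M nabla X Y (nabla Z U)
      + curvature M nabla Z (lie_bracket M X Y) U) = 0"
proof -
  have "nabla (lie_bracket M X (lie_bracket M Y Z) + lie_bracket M Y (lie_bracket M Z X)
    + lie_bracket M Z (lie_bracket M X Y)) U = 0" using jacobi[OF assms(1-3)] by simp
  then have "nabla (lie_bracket M X (lie_bracket M Y Z)) U + nabla (lie_bracket M Y (lie_bracket M Z X)) U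
    + nabla (lie_bracket M Z (lie_bracket M X Y)) U = 0" by simp
  then show ?thesis
    unfolding curvature_def by (simp add: algebra_simps)
qed

text \<open>
  The trace of the rank-one endomorphism \<open>u \<mapsto> g(u,Z) Y\<close>. The curvature endomorphism \<open>X \<mapsto> R(X,Y)Z\<close> of a
  Kenmotsu manifold of dimension three will be a sum of such endomorphisms and a multiple of the identity.
\<close>

lemma coordinate_trace:
  assumes c: "(U, h) \<in> atlas M" "p \<in> U" and "vf Y" "vf Z"
  shows "(\<Sum>i\<in>UNIV. g p (chart_tangent M (U, h) p (axis i 1)) (Z p) * Y p (\<lambda>q. h q $ i)) = ip Y Z p"
proof -
  have p: "p \<in> points M" using c chart_subset by blast
  have Z: "Z p \<in> tangent_space M p" using vf_tangent[OF assms(4) p] .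
  let ?L = "\<lambda>v. g p (chart_tangent M (U, h) p v) (Z p)"
  have l: "linear ?L"
    by (rule linearI)
       (simp_all add: chart_tangent_add[OF c] chart_tangent_scale[OF c] g_add g_scale p Z chart_tangent_in[OF c])
  let ?v = "\<chi> i. Y p (\<lambda>q. h q $ i)"
  have "ip Y Z p = ?L ?v"
    unfolding ip_def using tangent_coords[OF c vf_tangent[OF assms(3) p]] by simp
  also have "?v = (\<Sum>i\<in>UNIV. Y p (\<lambda>q. h q $ i) *\<^sub>R axis i 1)"
    by (simp add: vec_eq_iff axis_def if_distrib cong: if_cong)
  also have "?L \<dots> = (\<Sum>i\<in>UNIV. ?L (axis i 1) * Y p (\<lambda>q. h q $ i))"
    by (simp add: linear_sum[OF l] linear_scale[OF l] mult.commute)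
  finally show ?thesis ..
qed

end

section \<open>Kenmotsu structures in dimension three\<close>

locale kenmotsu3 = levi_civita_mfd M g nabla
  for M :: "('a, 3) manifold"
    and g :: "'a \<Rightarrow> 'a tangent \<Rightarrow> 'a tangent \<Rightarrow> real"
    and nabla :: "'a vfield \<Rightarrow> 'a vfield \<Rightarrow> 'a vfield" +
  fixes \<phi> :: "'a \<Rightarrow> 'a tangent \<Rightarrow> 'a tangent"
    and \<xi> :: "'a vfield"
    and \<eta> :: "'a \<Rightarrow> 'a tangent \<Rightarrow> real"
    and \<epsilon> :: real
  assumes kenmotsu: "kenmotsu_pseudo_metric M \<phi> \<xi> \<eta> g \<epsilon> nabla"
begin

definition \<Phi> :: "'a vfield \<Rightarrow> 'a vfield" where "\<Phi> X = endo_apply M \<phi> X"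

lemma contact: "almost_contact_pseudo_metric M \<phi> \<xi> \<eta> g \<epsilon>"
  using kenmotsu unfolding kenmotsu_pseudo_metric_def by blast

lemma endo: "endo_field M \<phi>" and oneform: "one_form M \<eta>" and xi_vf [simp]: "vf \<xi>"
  and eps: "\<epsilon> \<in> {1, -1}"
  using contact unfolding almost_contact_pseudo_metric_def by blast+

lemma eps_sq [simp]: "\<epsilon> * \<epsilon> = 1" "\<epsilon> * (\<epsilon> * x) = x"
  using eps by auto

lemma eps_nonzero [simp]: "\<epsilon> \<noteq> 0" using eps by auto

lemma phi_phi: "p \<in> points M \<Longrightarrow> u \<in> tangent_space M p \<Longrightarrow> \<phi> p (\<phi> p u) = - u + scale_tangent (\<eta> p u) (\<xi> p)"
  and eta_xi: "p \<in> points M \<Longrightarrow> \<eta> p (\<xi> p) = 1"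
  and phi_xi: "p \<in> points M \<Longrightarrow> \<phi> p (\<xi> p) = 0"
  and eta_phi: "p \<in> points M \<Longrightarrow> u \<in> tangent_space M p \<Longrightarrow> \<eta> p (\<phi> p u) = 0"
  using contact unfolding almost_contact_pseudo_metric_def by blast+

lemma phi_compat: "vf X \<Longrightarrow> vf Y \<Longrightarrow> p \<in> points M \<Longrightarrow>
    g p (\<phi> p (X p)) (\<phi> p (Y p)) = ip X Y p - \<epsilon> * \<eta> p (X p) * \<eta> p (Y p)"
  using contact unfolding almost_contact_pseudo_metric_def ip_def by blast

lemma phi_in: "p \<in> points M \<Longrightarrow> u \<in> tangent_space M p \<Longrightarrow> \<phi> p u \<in> tangent_space M p"
  and phi_add: "p \<in> points M \<Longrightarrow> u \<in> tangent_space M p \<Longrightarrow> v \<in> tangent_space M p \<Longrightarrow> \<phi> p (u + v) = \<phi> p u + \<phi> p v"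
  and phi_scale: "p \<in> points M \<Longrightarrow> u \<in> tangent_space M p \<Longrightarrow> \<phi> p (scale_tangent a u) = scale_tangent a (\<phi> p u)"
  using endo unfolding endo_field_def by blast+

lemma eta_add: "p \<in> points M \<Longrightarrow> u \<in> tangent_space M p \<Longrightarrow> v \<in> tangent_space M p \<Longrightarrow> \<eta> p (u + v) = \<eta> p u + \<eta> p v"
  and eta_scale: "p \<in> points M \<Longrightarrow> u \<in> tangent_space M p \<Longrightarrow> \<eta> p (scale_tangent a u) = a * \<eta> p u"
  using oneform unfolding one_form_def by blast+

lemma Phi_vf [simp]: "vf X \<Longrightarrow> vf (\<Phi> X)"
  using endo unfolding endo_field_def \<Phi>_def by blast

lemma Phi_at: "p \<in> points M \<Longrightarrow> \<Phi> X p = \<phi> p (X p)"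
  and Phi_outside: "p \<notin> points M \<Longrightarrow> \<Phi> X p = 0"
  by (simp_all add: \<Phi>_def endo_apply_def)

lemma Phi_add [simp]: "vf X \<Longrightarrow> vf Y \<Longrightarrow> \<Phi> (X + Y) = \<Phi> X + \<Phi> Y"
proof
  fix p assume "vf X" "vf Y"
  then show "\<Phi> (X + Y) p = (\<Phi> X + \<Phi> Y) p"
    by (cases "p \<in> points M") (simp_all add: Phi_at Phi_outside phi_add vf_tangent)
qed

lemma Phi_scale [simp]: "vf X \<Longrightarrow> \<Phi> (scale_field f X) = scale_field f (\<Phi> X)"
proof
  fix p assume "vf X"
  then show "\<Phi> (scale_field f X) p = scale_field f (\<Phi> X) p"
    by (cases "p \<in> points M")
      (simp_all add: Phi_at Phi_outside phi_scale vf_tangent scale_field_def, simp add: scale_tangent_def fun_eq_iff)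
qed

lemma Phi_uminus [simp]: "vf X \<Longrightarrow> \<Phi> (- X) = - \<Phi> X"
  by (simp add: uminus_field del: vf_uminus)

lemma Phi_diff [simp]: "vf X \<Longrightarrow> vf Y \<Longrightarrow> \<Phi> (X - Y) = \<Phi> X - \<Phi> Y"
  by (simp add: diff_field)

lemma Phi_xi [simp]: "\<Phi> \<xi> = 0"
proof
  fix p show "\<Phi> \<xi> p = 0 p" by (cases "p \<in> points M") (simp_all add: Phi_at Phi_outside phi_xi)
qed

text \<open>
  Compatibility of \<open>\<phi>\<close> with the metric, applied to \<open>X\<close> and \<open>\<xi>\<close>, where \<open>\<phi> \<xi> = 0\<close>. From here on \<open>\<eta>\<close> is eliminated in
  favour of the metric.
\<close>

lemma eta_ip: "vf X \<Longrightarrow> p \<in> points M \<Longrightarrow> \<eta> p (X p) = \<epsilon> * ip X \<xi> p"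
proof -
  assume a: "vf X" "p \<in> points M"
  have "g p (\<phi> p (X p)) (\<phi> p (\<xi> p)) = ip (\<Phi> X) 0 p"
    using a by (simp add: ip_def Phi_at phi_xi)
  also have "\<dots> = 0" using a by simp
  finally have "ip X \<xi> p = \<epsilon> * \<eta> p (X p)" using phi_compat[OF a(1) xi_vf a(2)] by (simp add: eta_xi a)
  then show ?thesis by simp
qed

lemma ip_xi_xi [simp]: "p \<in> points M \<Longrightarrow> ip \<xi> \<xi> p = \<epsilon>"
  using eta_ip[OF xi_vf] eta_xi eps by force

lemma ip_Phi_xi [simp]: "vf X \<Longrightarrow> p \<in> points M \<Longrightarrow> ip (\<Phi> X) \<xi> p = 0"
  using eta_ip[OF Phi_vf[of X], of p] eta_phi[OF _ vf_tangent, of p X] eps by (auto simp: Phi_at)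

lemma ip_xi_Phi [simp]: "vf X \<Longrightarrow> p \<in> points M \<Longrightarrow> ip \<xi> (\<Phi> X) p = 0"
  by (simp add: ip_sym[of \<xi>])

lemma Phi_Phi [simp]: "vf X \<Longrightarrow> \<Phi> (\<Phi> X) = scale_field (\<lambda>p. \<epsilon> * ip X \<xi> p) \<xi> - X"
proof
  fix p assume a: "vf X"
  show "\<Phi> (\<Phi> X) p = (scale_field (\<lambda>p. \<epsilon> * ip X \<xi> p) \<xi> - X) p"
  proof (cases "p \<in> points M")
    case True
    then show ?thesis
      by (simp add: Phi_at phi_phi vf_tangent a eta_ip scale_field_def)
  next
    case False
    then show ?thesis by (simp add: Phi_outside fun_eq_iff scale_field_apply vf_outside[OF a] vf_outside[OF xi_vf])
  qed
qed

lemma ip_Phi_Phi [simp]: "vf X \<Longrightarrow> vf Y \<Longrightarrow> p \<in> points M \<Longrightarrow>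
    ip (\<Phi> X) (\<Phi> Y) p = ip X Y p - \<epsilon> * ip X \<xi> p * ip Y \<xi> p"
  using phi_compat[of X Y p] by (simp add: ip_def[of "\<Phi> X"] Phi_at eta_ip)

lemma ip_Phi: "vf X \<Longrightarrow> vf Y \<Longrightarrow> p \<in> points M \<Longrightarrow> ip X (\<Phi> Y) p = - ip (\<Phi> X) Y p"
  using ip_Phi_Phi[of X "\<Phi> Y" p] by (simp add: ip_sym[of _ \<xi>] del: ip_Phi_Phi)

lemma ip_Phi_self [simp]: "vf X \<Longrightarrow> p \<in> points M \<Longrightarrow> ip (\<Phi> X) X p = 0"
  using ip_Phi[of X X p] ip_sym[of X "\<Phi> X" p] by simp

lemma nabla_Phi [simp]: "vf X \<Longrightarrow> vf Y \<Longrightarrow> nabla X (\<Phi> Y) = \<Phi> (nabla X Y)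
    - scale_field (\<lambda>p. \<epsilon> * ip Y \<xi> p) (\<Phi> X) + scale_field (\<lambda>p. \<epsilon> * ip (\<Phi> X) Y p) \<xi>"
proof -
  assume a: "vf X" "vf Y"
  have k: "nabla X (\<Phi> Y) - \<Phi> (nabla X Y) = - scale_field (\<lambda>p. \<eta> p (Y p)) (\<Phi> X)
      - scale_field (\<lambda>p. \<epsilon> * g p (X p) (\<phi> p (Y p))) \<xi>"
    using kenmotsu a unfolding kenmotsu_pseudo_metric_def cov_deriv_endo_def \<Phi>_def by blast
  have "scale_field (\<lambda>p. \<eta> p (Y p)) (\<Phi> X) = scale_field (\<lambda>p. \<epsilon> * ip Y \<xi> p) (\<Phi> X)"
  proof (intro ext)
    fix p k show "scale_field (\<lambda>p. \<eta> p (Y p)) (\<Phi> X) p k = scale_field (\<lambda>p. \<epsilon> * ip Y \<xi> p) (\<Phi> X) p k"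
      using a by (cases "p \<in> points M") (simp_all add: scale_field_apply eta_ip Phi_outside)
  qed
  moreover have "scale_field (\<lambda>p. \<epsilon> * g p (X p) (\<phi> p (Y p))) \<xi> = - scale_field (\<lambda>p. \<epsilon> * ip (\<Phi> X) Y p) \<xi>"
  proof (intro ext)
    fix p k
    have "g p (X p) (\<phi> p (Y p)) = - ip (\<Phi> X) Y p" if "p \<in> points M"
      using ip_Phi[OF a that] that by (simp add: ip_def Phi_at)
    then show "scale_field (\<lambda>p. \<epsilon> * g p (X p) (\<phi> p (Y p))) \<xi> p k = (- scale_field (\<lambda>p. \<epsilon> * ip (\<Phi> X) Y p) \<xi>) p k"
      by (cases "p \<in> points M") (simp_all add: scale_field_apply vf_outside[OF xi_vf])
  qed
  ultimately show ?thesis using k by (simp add: algebra_simps)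
qed

text \<open>
  The Kenmotsu identity for \<open>Y = \<xi>\<close> reads \<open>\<Phi> (\<nabla>\<^sub>X \<xi>) = \<Phi> X\<close>, which determines the horizontal part of \<open>\<nabla>\<^sub>X \<xi>\<close>; the
  other part vanishes because \<open>\<langle>\<xi>,\<xi>\<rangle>\<close> is constant.
\<close>

lemma nabla_xi [simp]: "vf X \<Longrightarrow> nabla X \<xi> = X - scale_field (\<lambda>p. \<epsilon> * ip X \<xi> p) \<xi>"
proof -
  assume a [simp]: "vf X"
  have 0: "ip (nabla X \<xi>) \<xi> p = 0" if "p \<in> points M" for p
  proof -
    have "dir X (ip \<xi> \<xi>) p = dir X (\<lambda>q. \<epsilon>) p" by (rule dir_cong[OF a that]) simp
    then show ?thesis using that ip_sym[of \<xi> "nabla X \<xi>" p] by simp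
  qed
  have "nabla X (\<Phi> \<xi>) = \<Phi> (nabla X \<xi>)
    - scale_field (\<lambda>p. \<epsilon> * ip \<xi> \<xi> p) (\<Phi> X) + scale_field (\<lambda>p. \<epsilon> * ip (\<Phi> X) \<xi> p) \<xi>"
    by (rule nabla_Phi) simp_all
  then have 1: "ip (\<Phi> (nabla X \<xi>)) (\<Phi> Z) p = ip (\<Phi> X) (\<Phi> Z) p" if "p \<in> points M" "vf Z" for p Z
  proof -
    have "ip (\<Phi> (nabla X \<xi>) - scale_field (\<lambda>p. \<epsilon> * ip \<xi> \<xi> p) (\<Phi> X) + scale_field (\<lambda>p. \<epsilon> * ip (\<Phi> X) \<xi> p) \<xi>) (\<Phi> Z) p = 0"
      using that \<open>nabla X (\<Phi> \<xi>) = _\<close> by simp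
    then show ?thesis using that by (simp del: ip_Phi_Phi)
  qed
  show ?thesis
  proof (rule vf_eqI)
    fix p Z assume "p \<in> points M" "vf Z"
    with 1[of p Z] 0[of p] show "ip (nabla X \<xi>) Z p = ip (X - scale_field (\<lambda>p. \<epsilon> * ip X \<xi> p) \<xi>) Z p"
      by (simp add: ip_sym[of \<xi> Z])
  qed simp_all
qed


section \<open>Horizontal frames\<close>

text \<open>
  On \<open>ker \<eta>\<close> the endomorphism \<open>\<phi>\<close> is a complex structure, so \<open>e\<close> and \<open>\<phi> e\<close> are independent over the
  reals: \<open>a e + b \<phi> e = 0\<close> implies \<open>(a\<^sup>2 + b\<^sup>2) e = 0\<close>.
\<close>

lemma horizontal_independent:
  assumes p: "p \<in> points M" and e: "e \<in> tangent_space M p" "\<eta> p e = 0" "e \<noteq> 0"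
    and z: "scale_tangent a e + scale_tangent b (\<phi> p e) + scale_tangent c (\<xi> p) = 0"
  shows "a = 0" "b = 0" "c = 0"
proof -
  note T = p e(1) phi_in[OF p e(1)] vf_tangent[OF xi_vf p] tangent_scale[OF p] tangent_add[OF p] tangent_zero[OF p]
  have "\<eta> p (scale_tangent a e + scale_tangent b (\<phi> p e) + scale_tangent c (\<xi> p)) = c"
    by (simp add: T eta_add eta_scale eta_phi eta_xi e(2))
  moreover have "\<eta> p 0 = 0" using eta_add[OF p, of 0 0] T by simp
  ultimately show c: "c = 0" unfolding z by simp
  then have z': "scale_tangent a e + scale_tangent b (\<phi> p e) = 0"
    using z by (simp add: scale_tangent_def fun_eq_iff)
  have "\<phi> p (scale_tangent a e + scale_tangent b (\<phi> p e)) = scale_tangent a (\<phi> p e) - scale_tangent b e"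
    by (simp add: T phi_add phi_scale phi_phi e(2)) (simp add: scale_tangent_def fun_eq_iff)
  moreover have "\<phi> p 0 = 0" using phi_add[OF p, of 0 0] T by simp
  ultimately have z'': "scale_tangent a (\<phi> p e) - scale_tangent b e = 0" unfolding z' by simp
  obtain k where k: "e k \<noteq> 0" using e(3) by (auto simp: fun_eq_iff)
  have "a * e k + b * \<phi> p e k = 0" "a * \<phi> p e k - b * e k = 0"
    using fun_cong[OF z', of k] fun_cong[OF z'', of k] by (simp_all add: scale_tangent_def)
  then have "(a * a + b * b) * e k = 0" by algebra
  then have "a * a + b * b = 0" using k by simp
  then show "a = 0" "b = 0" using sum_squares_eq_zero_iff by auto
qed

text \<open>
  The dimension enters here: in coordinates, combining the three independent vectors is an injective linear
  map of \<open>real ^ 3\<close> into itself, hence a surjective one.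
\<close>

lemma horizontal_span:
  assumes p: "p \<in> points M" and e: "e \<in> tangent_space M p" "\<eta> p e = 0" "e \<noteq> 0" and u: "u \<in> tangent_space M p"
  obtains a b c where "u = scale_tangent a e + scale_tangent b (\<phi> p e) + scale_tangent c (\<xi> p)"
proof -
  obtain U h where c: "(U, h) \<in> atlas M" "p \<in> U" using chart_at[OF p] .
  let ?ct = "chart_tangent M (U, h) p"
  let ?co = "\<lambda>u::'a tangent. (\<chi> i. u (\<lambda>q. h q $ i)) :: real ^ 3"
  have ct: "?ct (?co u) = u" if "u \<in> tangent_space M p" for u
    using tangent_coords[OF c that] by simp
  let ?L = "\<lambda>x::real^3. x $ 1 *\<^sub>R ?co e + x $ 2 *\<^sub>R ?co (\<phi> p e) + x $ 3 *\<^sub>R ?co (\<xi> p)"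
  have L: "?ct (?L x) = scale_tangent (x $ 1) e + scale_tangent (x $ 2) (\<phi> p e) + scale_tangent (x $ 3) (\<xi> p)" for x
    by (simp only: chart_tangent_add[OF c] chart_tangent_scale[OF c] ct[OF e(1)] ct[OF phi_in[OF p e(1)]]
        ct[OF vf_tangent[OF xi_vf p]])
  have lin: "linear ?L"
    by (rule linearI) (simp_all add: algebra_simps)
  have "?ct 0 = 0"
    using chart_tangent_scale[OF c, of 0 0] by (simp add: scale_tangent_def fun_eq_iff)
  then have "x = 0" if "?L x = 0" for x
  proof -
    assume "?ct 0 = 0"
    then have "scale_tangent (x $ 1) e + scale_tangent (x $ 2) (\<phi> p e) + scale_tangent (x $ 3) (\<xi> p) = 0"
      using L[of x] that by simp
    from horizontal_independent[OF p e this] show "x = 0" by (simp add: vec_eq_iff forall_3)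
  qed
  then have "inj ?L" using linear_injective_0[OF lin] by blast
  then have "surj ?L" using linear_injective_imp_surjective[OF lin] by blast
  then have "?co u \<in> range ?L" by simp
  then obtain x where x: "?co u = ?L x" by (rule rangeE)
  have "u = ?ct (?L x)" by (simp only: x[symmetric] ct[OF u])
  also note L
  finally show ?thesis by (rule that)
qed

definition horizontal :: "'a vfield \<Rightarrow> bool" where
  "horizontal X \<longleftrightarrow> vf X \<and> (\<forall>p\<in>points M. ip X \<xi> p = 0)"

lemma horizontal_vf [simp]: "horizontal X \<Longrightarrow> vf X"
  and horizontal_xi [simp]: "horizontal X \<Longrightarrow> p \<in> points M \<Longrightarrow> ip X \<xi> p = 0"
  by (simp_all add: horizontal_def)

lemma xi_horizontal [simp]: "horizontal X \<Longrightarrow> p \<in> points M \<Longrightarrow> ip \<xi> X p = 0"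
  by (simp add: ip_sym[of \<xi>])

lemma horizontal_Phi [simp]: "vf X \<Longrightarrow> horizontal (\<Phi> X)"
  unfolding horizontal_def by simp

text \<open>
  Although the metric may be indefinite, a horizontal vector \<open>e \<noteq> 0\<close> is never null: it is orthogonal to
  \<open>\<phi> e\<close> and to \<open>\<xi>\<close>, so if it were orthogonal to itself it would be orthogonal to the whole tangent space.
\<close>

lemma horizontal_frame:
  assumes p: "p \<in> points M"
  obtains E where "horizontal E" "ip E E p \<noteq> 0"
proof -
  obtain U h where c: "(U, h) \<in> atlas M" "p \<in> U" using chart_at[OF p] .
  let ?ct = "chart_tangent M (U, h) p"
  have "\<exists>u\<in>tangent_space M p. \<forall>a. u \<noteq> scale_tangent a (\<xi> p)"
  proof (rule ccontr)
    assume "\<not> ?thesis"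
    then have *: "\<exists>a. ?ct v = scale_tangent a (\<xi> p)" for v
      using chart_tangent_in[OF c] by blast
    obtain a b where ab: "?ct (axis 1 1) = scale_tangent a (\<xi> p)" "?ct (axis 2 1) = scale_tangent b (\<xi> p)"
      using *[of "axis 1 1"] *[of "axis 2 1"] by blast
    have x: "a * \<xi> p (\<lambda>q. h q $ i) = axis 1 1 $ i" "b * \<xi> p (\<lambda>q. h q $ i) = axis 2 1 $ i" for i
      using chart_tangent_coord[OF c, of "axis 1 1" i] chart_tangent_coord[OF c, of "axis 2 1" i]
      unfolding ab scale_tangent_def by simp_all
    show False using x[of 1] x[of 2] by (auto simp: axis_def)
  qed
  then obtain u where u: "u \<in> tangent_space M p" "\<And>a. u \<noteq> scale_tangent a (\<xi> p)" by blast
  obtain X where X: "vf X" "X p = u" using vector_field_extension[OF p u(1)] .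
  define E where "E = X - scale_field (\<lambda>p. \<epsilon> * ip X \<xi> p) \<xi>"
  have E: "vf E" unfolding E_def using X by simp
  have h: "ip E \<xi> q = 0" if "q \<in> points M" for q
    unfolding E_def using X that by simp
  have "E p \<noteq> 0"
    using u(2)[of "\<epsilon> * ip X \<xi> p"] X(2) by (simp add: E_def scale_field_def)
  moreover have "E p = 0" if 0: "ip E E p = 0"
  proof (rule vf_eqI_at[OF E vf_zero p, simplified])
    fix Z assume Z: "vf Z"
    show "ip E Z p = ip 0 Z p"
    proof (cases "E p = 0")
      case False
      have "\<eta> p (E p) = 0" using eta_ip[OF E p] h[OF p] by simp
      from horizontal_span[OF p vf_tangent[OF E p] this False vf_tangent[OF Z p]]
      obtain a b c where "Z p = scale_tangent a (E p) + scale_tangent b (\<phi> p (E p)) + scale_tangent c (\<xi> p)" .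
      then have "Z p = (scale_field (\<lambda>p. a) E + scale_field (\<lambda>p. b) (\<Phi> E) + scale_field (\<lambda>p. c) \<xi>) p"
        using p by (simp add: scale_field_def Phi_at)
      then have "ip E Z p = ip E (scale_field (\<lambda>p. a) E + scale_field (\<lambda>p. b) (\<Phi> E) + scale_field (\<lambda>p. c) \<xi>) p"
        unfolding ip_def by simp
      then show ?thesis using E Z p 0 h[OF p] by (simp add: ip_Phi)
    qed (use Z p in \<open>simp add: ip_def\<close>)
  qed
  ultimately show ?thesis using that E h unfolding horizontal_def by blast
qed

text \<open>
  The expansion of \<open>X\<close> in the frame \<open>E\<close>, \<open>\<Phi> E\<close>, \<open>\<xi>\<close>, multiplied by \<open>\<langle>E,E\<rangle>\<close>. Where \<open>E\<close> vanishes both sides are \<open>0\<close>, so this is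
  an identity between global fields. Function-linear maps can be evaluated with it at every
  point where \<open>\<langle>E,E\<rangle> \<noteq> 0\<close>.
\<close>

lemma frame_expansion:
  assumes h: "horizontal E" and X [simp]: "vf X"
  shows "scale_field (ip E E) X = scale_field (\<lambda>p. ip E E p * (\<epsilon> * ip X \<xi> p)) \<xi>
    + scale_field (ip X E) E + scale_field (ip X (\<Phi> E)) (\<Phi> E)" (is "?l = ?r")
proof (intro ext)
  note E [simp] = horizontal_vf[OF h]
  fix p k
  consider "p \<notin> points M" | "p \<in> points M" "E p = 0" | "p \<in> points M" "E p \<noteq> 0" by blast
  then show "?l p k = ?r p k"
  proof cases
    case 1
    then show ?thesis
      by (simp add: scale_field_apply vf_outside[OF X] vf_outside[OF E] vf_outside[OF xi_vf] vf_outside[OF Phi_vf[OF E]])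
  next
    case 2
    have "\<phi> p 0 = 0" using phi_add[OF 2(1), of 0 0] tangent_zero[OF 2(1)] by simp
    then have "\<Phi> E p = 0" using 2 by (simp add: Phi_at)
    moreover have "ip E E p = 0" using 2 ip_zero_left[of E p] by (simp add: ip_def)
    ultimately show ?thesis using 2 by (simp add: scale_field_apply)
  next
    case 3
    note p [simp] = 3(1)
    have "\<eta> p (E p) = 0" using eta_ip[OF E p] h by simp
    from horizontal_span[OF p vf_tangent[OF E p] this 3(2) vf_tangent[OF X p]]
    obtain a b c where "X p = scale_tangent a (E p) + scale_tangent b (\<phi> p (E p)) + scale_tangent c (\<xi> p)" .
    then have Xp: "X p = (scale_field (\<lambda>p. a) E + scale_field (\<lambda>p. b) (\<Phi> E) + scale_field (\<lambda>p. c) \<xi>) p"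
      by (simp add: scale_field_def Phi_at)
    then have "ip X Z p = ip (scale_field (\<lambda>p. a) E + scale_field (\<lambda>p. b) (\<Phi> E) + scale_field (\<lambda>p. c) \<xi>) Z p" for Z
      unfolding ip_def by simp
    then have i: "ip X E p = a * ip E E p" "ip X (\<Phi> E) p = b * ip E E p" "ip X \<xi> p = c * \<epsilon>"
      using h by (simp_all add: ip_Phi)
    have "X p k = a * E p k + b * \<Phi> E p k + c * \<xi> p k"
      unfolding Xp by (simp add: scale_field_apply)
    then show ?thesis
      by (simp add: scale_field_apply i algebra_simps)
  qed
qed

text \<open>
  A skew form that annihilates \<open>\<xi>\<close> lives on a plane, so it is a multiple of the area form \<open>\<langle>\<Phi>X,Y\<rangle>\<close>.
  This is applied twice to the curvature tensor and once to the skew part of \<open>\<nabla>V\<close>.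
\<close>

lemma area_form:
  fixes \<beta> :: "'a vfield \<Rightarrow> 'a vfield \<Rightarrow> real"
  assumes p [simp]: "p \<in> points M"
    and add: "\<And>X Y Z. vf X \<Longrightarrow> vf Y \<Longrightarrow> vf Z \<Longrightarrow> \<beta> (X + Y) Z = \<beta> X Z + \<beta> Y Z"
    and scale: "\<And>f X Z. sf f \<Longrightarrow> vf X \<Longrightarrow> vf Z \<Longrightarrow> \<beta> (scale_field f X) Z = f p * \<beta> X Z"
    and skew: "\<And>X Y. vf X \<Longrightarrow> vf Y \<Longrightarrow> \<beta> X Y = - \<beta> Y X"
    and xi: "\<And>X. vf X \<Longrightarrow> \<beta> \<xi> X = 0"
    and h: "horizontal E" and s: "ip E E p \<noteq> 0"
    and X [simp]: "vf X" and Y [simp]: "vf Y"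
  shows "\<beta> X Y = \<beta> E (\<Phi> E) / ip E E p * ip (\<Phi> X) Y p"
proof -
  note E [simp] = horizontal_vf[OF h]
  let ?s = "ip E E p"
  have ex: "?s * \<beta> Z W = ip Z E p * \<beta> E W + ip Z (\<Phi> E) p * \<beta> (\<Phi> E) W" if [simp]: "vf Z" "vf W" for Z W
  proof -
    have "?s * \<beta> Z W = \<beta> (scale_field (ip E E) Z) W" by (simp add: scale)
    also have "\<dots> = ip Z E p * \<beta> E W + ip Z (\<Phi> E) p * \<beta> (\<Phi> E) W"
      unfolding frame_expansion[OF h that(1), simplified] by (simp add: add scale xi)
    finally show ?thesis .
  qed
  have 0: "\<beta> Z Z = 0" if "vf Z" for Z using skew[OF that that] by simp
  have "?s * \<beta> E Y = - (?s * \<beta> Y E)" using skew[of E Y] by simp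
  then have e1: "?s * \<beta> E Y = ip Y (\<Phi> E) p * \<beta> E (\<Phi> E)"
    using ex[of Y E] 0[of E] skew[of "\<Phi> E" E] by simp
  have "?s * \<beta> (\<Phi> E) Y = - (?s * \<beta> Y (\<Phi> E))" using skew[of "\<Phi> E" Y] by simp
  then have e2: "?s * \<beta> (\<Phi> E) Y = - (ip Y E p * \<beta> E (\<Phi> E))"
    using ex[of Y "\<Phi> E"] 0[of "\<Phi> E"] by simp
  have "ip (scale_field (ip E E) X) (\<Phi> Y) p = ip X E p * ip E (\<Phi> Y) p + ip X (\<Phi> E) p * ip (\<Phi> E) (\<Phi> Y) p"
    unfolding frame_expansion[OF h X, simplified] by simp
  then have w: "?s * ip (\<Phi> X) Y p = ip X E p * ip Y (\<Phi> E) p - ip X (\<Phi> E) p * ip Y E p"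
    using h by (simp add: ip_Phi ip_sym[of E Y] ip_sym[of "\<Phi> E" Y])
  have "?s * (?s * \<beta> X Y) = ip X E p * (?s * \<beta> E Y) + ip X (\<Phi> E) p * (?s * \<beta> (\<Phi> E) Y)"
    unfolding ex[OF X Y] by (simp add: algebra_simps)
  also have "\<dots> = \<beta> E (\<Phi> E) * (?s * ip (\<Phi> X) Y p)"
    unfolding e1 e2 w by (simp add: algebra_simps)
  finally show ?thesis using s by (simp add: field_simps)
qed

definition hor :: "'a vfield \<Rightarrow> 'a vfield" where
  "hor X = X - scale_field (\<lambda>p. \<epsilon> * ip X \<xi> p) \<xi>"

lemma horizontal_hor [simp]: "vf X \<Longrightarrow> horizontal (hor X)"
  unfolding horizontal_def by (simp add: hor_def)

lemma hor_split: "X = hor X + scale_field (\<lambda>p. \<epsilon> * ip X \<xi> p) \<xi>"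
  by (simp add: hor_def)

lemma ip_hor [simp]: "vf X \<Longrightarrow> horizontal Y \<Longrightarrow> p \<in> points M \<Longrightarrow> ip (hor X) Y p = ip X Y p"
  by (simp add: hor_def)

lemma ip_split:
  assumes "vf X" "vf Z" "p \<in> points M"
  shows "ip X Z p = ip X (hor Z) p + \<epsilon> * ip Z \<xi> p * ip X \<xi> p"
  using assms by (simp add: hor_def)

lemma nabla_horizontal_xi:
  assumes [simp]: "horizontal X" "vf Y" "p \<in> points M"
  shows "ip (nabla Y X) \<xi> p = - ip X Y p"
proof -
  have "dir Y (ip X \<xi>) p = dir Y (\<lambda>q. 0) p" by (rule dir_cong) simp_all
  then show ?thesis by simp
qed

text \<open>
  A one-form that vanishes on non-null horizontal fields vanishes on all of them. This extends
  identities derived from a frame to fields that may vanish at \<open>p\<close>.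
\<close>

lemma horizontal_form_zeroI:
  fixes \<alpha> :: "'a vfield \<Rightarrow> real"
  assumes p [simp]: "p \<in> points M" and h [simp]: "horizontal X"
    and add: "\<And>X Y. vf X \<Longrightarrow> vf Y \<Longrightarrow> \<alpha> (X + Y) = \<alpha> X + \<alpha> Y"
    and scale: "\<And>f X. sf f \<Longrightarrow> vf X \<Longrightarrow> \<alpha> (scale_field f X) = f p * \<alpha> X"
    and zero: "\<And>E. horizontal E \<Longrightarrow> ip E E p \<noteq> 0 \<Longrightarrow> \<alpha> E = 0"
  shows "\<alpha> X = 0"
proof -
  obtain E where E [simp]: "horizontal E" and s: "ip E E p \<noteq> 0"
    by (rule horizontal_frame[OF p])
  have "ip E E p * \<alpha> X = \<alpha> (scale_field (ip E E) X)" by (simp add: scale)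
  also have "\<dots> = 0"
    using s unfolding frame_expansion[OF E horizontal_vf[OF h]] by (simp add: add scale zero)
  finally show ?thesis using s by simp
qed

lemma frame_ip:
  assumes h [simp]: "horizontal E" and [simp]: "horizontal X" "vf Y" "p \<in> points M"
  shows "ip E E p * ip X Y p = ip E X p * ip E Y p + ip (\<Phi> E) X p * ip (\<Phi> E) Y p"
proof -
  have "ip E E p * ip X Y p = ip (scale_field (ip E E) X) Y p" by simp
  also have "\<dots> = ip E X p * ip E Y p + ip (\<Phi> E) X p * ip (\<Phi> E) Y p"
    unfolding frame_expansion[OF h horizontal_vf[OF assms(2)]]
    by (simp add: ip_sym[of X E] ip_sym[of X "\<Phi> E"])
  finally show ?thesis .
qed


section \<open>The curvature of a Kenmotsu manifold of dimension three\<close>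

lemma sf_riemann [simp]: "vf X \<Longrightarrow> vf Y \<Longrightarrow> vf Z \<Longrightarrow> vf W \<Longrightarrow> sf (riemann X Y Z W)"
  unfolding riemann_def[abs_def] by simp

lemma riemann_xi:
  assumes [simp]: "vf X" "vf Y" "vf Z" "p \<in> points M"
  shows "riemann X Y \<xi> Z p = \<epsilon> * (ip X \<xi> p * ip Y Z p - ip Y \<xi> p * ip X Z p)"
  unfolding riemann_def
  by (simp add: curvature_eq algebra_simps ip_sym[of Y X])

text \<open>
  The deviation of the curvature tensor from that of constant curvature \<open>-\<epsilon>\<close>.
\<close>

definition excess :: "'a vfield \<Rightarrow> 'a vfield \<Rightarrow> 'a vfield \<Rightarrow> 'a vfield \<Rightarrow> 'a \<Rightarrow> real" where
  "excess X Y Z W p = riemann X Y Z W p + \<epsilon> * (ip Y Z p * ip X W p - ip X Z p * ip Y W p)"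

lemma excess_pair_sym:
  "vf X \<Longrightarrow> vf Y \<Longrightarrow> vf Z \<Longrightarrow> vf W \<Longrightarrow> p \<in> points M \<Longrightarrow> excess X Y Z W p = excess Z W X Y p"
  unfolding excess_def using riemann_pair_sym[of X Y Z W p]
  by (simp add: ip_sym[of Z X] ip_sym[of Z Y] ip_sym[of W X] ip_sym[of W Y])

text \<open>
  The excess vanishes for \<open>X = \<xi>\<close>: by pair symmetry this is the formula for \<open>R(X,Y)\<xi>\<close>.
\<close>

lemma excess_area_form:
  assumes p [simp]: "p \<in> points M" and [simp]: "vf X" "vf Y" "vf Z" "vf W"
    and h [simp]: "horizontal E" and s: "ip E E p \<noteq> 0"
  shows "excess X Y Z W p = excess E (\<Phi> E) Z W p / ip E E p * ip (\<Phi> X) Y p"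
proof (rule area_form[OF p _ _ _ _ h s])
  show "excess (X1 + X2) Y Z W p = excess X1 Y Z W p + excess X2 Y Z W p"
    if "vf X1" "vf X2" "vf Y" for X1 X2 Y
    using that by (simp add: excess_def riemann_add algebra_simps)
  show "excess (scale_field f X1) Y Z W p = f p * excess X1 Y Z W p"
    if "sf f" "vf X1" "vf Y" for f X1 Y
    using that by (simp add: excess_def riemann_scale algebra_simps)
  show "excess X1 Y Z W p = - excess Y X1 Z W p" if "vf X1" "vf Y" for X1 Y
    using that riemann_skew1[of X1 Y Z W p] by (simp add: excess_def algebra_simps)
  show "excess \<xi> Y Z W p = 0" if "vf Y" for Y
    using that riemann_pair_sym[of \<xi> Y Z W p] riemann_xi[of Z W Y p]
    by (simp add: excess_def algebra_simps ip_sym[of Y Z] ip_sym[of Y W] ip_sym[of \<xi> Z] ip_sym[of \<xi> W])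
qed simp_all

lemma excess_exists:
  assumes p [simp]: "p \<in> points M"
  shows "\<exists>x. \<forall>X Y Z W. vf X \<longrightarrow> vf Y \<longrightarrow> vf Z \<longrightarrow> vf W \<longrightarrow>
    excess X Y Z W p = - x * ip (\<Phi> X) Y p * ip (\<Phi> Z) W p"
proof -
  obtain E where E: "horizontal E" "ip E E p \<noteq> 0"
    by (rule horizontal_frame[OF p])
  have "excess X Y Z W p =
      - (- excess E (\<Phi> E) E (\<Phi> E) p / (ip E E p * ip E E p)) * ip (\<Phi> X) Y p * ip (\<Phi> Z) W p"
    if "vf X" "vf Y" "vf Z" "vf W" for X Y Z W
    using excess_area_form[OF p that E] excess_area_form[OF p that(3,4) horizontal_vf[OF E(1)] Phi_vf[OF horizontal_vf[OF E(1)]] E]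
      excess_pair_sym[of E "\<Phi> E" Z W p] that E(1) by simp
  then show ?thesis by blast
qed

text \<open>
  Minus the coefficient of the excess with respect to the square of the area form; the choice is unique, since
  \<open>\<langle>\<Phi>E,\<Phi>E\<rangle>\<^sup>2 \<noteq> 0\<close> for a non-null horizontal \<open>E\<close>.
\<close>

definition \<kappa> :: "'a \<Rightarrow> real" where
  "\<kappa> p = (SOME x. \<forall>X Y Z W. vf X \<longrightarrow> vf Y \<longrightarrow> vf Z \<longrightarrow> vf W \<longrightarrow>
    excess X Y Z W p = - x * ip (\<Phi> X) Y p * ip (\<Phi> Z) W p)"

lemma excess_kappa:
  "p \<in> points M \<Longrightarrow> vf X \<Longrightarrow> vf Y \<Longrightarrow> vf Z \<Longrightarrow> vf W \<Longrightarrow>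
    excess X Y Z W p = - \<kappa> p * ip (\<Phi> X) Y p * ip (\<Phi> Z) W p"
  using someI_ex[OF excess_exists] unfolding \<kappa>_def[symmetric] by blast

lemma sf_kappa [simp]: "sf \<kappa>"
proof (rule smooth_fun_quotient)
  fix p assume p: "p \<in> points M"
  obtain E where h [simp]: "horizontal E" and s: "ip E E p \<noteq> 0"
    by (rule horizontal_frame[OF p])
  have "sf (\<lambda>q. ip E E q * ip E E q)" "sf (\<lambda>q. - excess E (\<Phi> E) E (\<Phi> E) q)"
    unfolding excess_def by simp_all
  moreover have "ip E E p * ip E E p \<noteq> 0" using s by simp
  moreover have "ip E E q * ip E E q * \<kappa> q = - excess E (\<Phi> E) E (\<Phi> E) q" if "q \<in> points M" for q
    using that excess_kappa[OF that, of E "\<Phi> E" E "\<Phi> E"] by simp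
  ultimately show "\<exists>d n. sf d \<and> sf n \<and> d p \<noteq> 0 \<and> (\<forall>q\<in>points M. d q * \<kappa> q = n q)" by blast
qed

lemma curvature_kappa:
  assumes [simp]: "vf X" "vf Y" "vf Z"
  shows "curvature M nabla X Y Z = scale_field (\<lambda>p. \<epsilon> * ip X Z p) Y - scale_field (\<lambda>p. \<epsilon> * ip Y Z p) X
    - scale_field (\<lambda>p. \<kappa> p * ip (\<Phi> X) Y p) (\<Phi> Z)"
proof (rule vf_eqI)
  fix p W assume [simp]: "p \<in> points M" "vf W"
  show "ip (curvature M nabla X Y Z) W p = ip (scale_field (\<lambda>p. \<epsilon> * ip X Z p) Y
    - scale_field (\<lambda>p. \<epsilon> * ip Y Z p) X - scale_field (\<lambda>p. \<kappa> p * ip (\<Phi> X) Y p) (\<Phi> Z)) W p"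
    using excess_kappa[of p X Y Z W] by (simp add: excess_def riemann_def algebra_simps)
qed simp_all

text \<open>
  The second Bianchi identity for \<open>\<xi>\<close>, \<open>E\<close>, \<open>\<Phi> E\<close>. The part of constant curvature is parallel and drops out. The derivative of the
  area form along a horizontal \<open>X\<close> comes from \<open>\<nabla>\<^sub>X \<xi> = X\<close> and contributes \<open>\<kappa>\<close> for each of \<open>E\<close> and \<open>\<Phi> E\<close>.
\<close>

lemma kappa_xi:
  assumes p [simp]: "p \<in> points M"
  shows "dir \<xi> \<kappa> p = - 2 * \<kappa> p"
proof -
  obtain E where h [simp]: "horizontal E" and s: "ip E E p \<noteq> 0"
    by (rule horizontal_frame[OF p])
  have "ip (nabla \<xi> (curvature M nabla E (\<Phi> E) (\<Phi> E)) - curvature M nabla E (\<Phi> E) (nabla \<xi> (\<Phi> E))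
      + curvature M nabla \<xi> (lie_bracket M E (\<Phi> E)) (\<Phi> E)
    + (nabla E (curvature M nabla (\<Phi> E) \<xi> (\<Phi> E)) - curvature M nabla (\<Phi> E) \<xi> (nabla E (\<Phi> E))
      + curvature M nabla E (lie_bracket M (\<Phi> E) \<xi>) (\<Phi> E))
    + (nabla (\<Phi> E) (curvature M nabla \<xi> E (\<Phi> E)) - curvature M nabla \<xi> E (nabla (\<Phi> E) (\<Phi> E))
      + curvature M nabla (\<Phi> E) (lie_bracket M \<xi> E) (\<Phi> E))) E p = 0"
    by (simp only: bianchi2[OF xi_vf horizontal_vf[OF h] Phi_vf[OF horizontal_vf[OF h]] Phi_vf[OF horizontal_vf[OF h]]]) simp
  then have "ip E E p * (ip E E p * dir \<xi> \<kappa> p) + 2 * (ip E E p * (ip E E p * \<kappa> p)) = 0"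
    by (simp add: curvature_kappa torsion_free) (simp add: ip_sym[of E "nabla \<xi> E"] algebra_simps)
  then have "(dir \<xi> \<kappa> p + 2 * \<kappa> p) * (ip E E p * ip E E p) = 0" by algebra
  then show ?thesis using s by auto
qed

text \<open>
  The first argument enters through its value at \<open>p\<close> alone, as is necessary for the trace that defines the
  Ricci tensor.
\<close>

lemma curvature_at:
  assumes "vf X" "vf Y" "vf Z" "p \<in> points M"
  shows "curvature M nabla X Y Z p k = \<epsilon> * g p (X p) (Z p) * Y p k - \<epsilon> * ip Y Z p * X p k
    + \<kappa> p * g p (X p) (\<Phi> Y p) * \<Phi> Z p k"
  using ip_Phi[of X Y p] assms by (simp add: curvature_kappa scale_field_apply ip_def)

lemma ricci_eq:
  assumes Y [simp]: "vf Y" and Z [simp]: "vf Z" and p [simp]: "p \<in> points M"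
  shows "ricci M nabla Y Z p =
    - 2 * \<epsilon> * ip Y Z p + \<kappa> p * (ip Y Z p - \<epsilon> * ip Y \<xi> p * ip Z \<xi> p)"
proof -
  define c where "c = (SOME c. c \<in> atlas M \<and> p \<in> fst c)"
  have "\<exists>c. c \<in> atlas M \<and> p \<in> fst c" using chart_at[OF p] by (metis fst_conv)
  then have "c \<in> atlas M \<and> p \<in> fst c" unfolding c_def by (rule someI_ex)
  then obtain U h where c: "c = (U, h)" "(U, h) \<in> atlas M" "p \<in> U" by (cases c) auto
  let ?d = "\<lambda>i. chart_tangent M (U, h) p (axis i 1)"
  have "curvature M nabla (SOME X. vf X \<and> X p = ?d i) Y Z p (\<lambda>q. h q $ i) =
      \<epsilon> * (g p (?d i) (Z p) * Y p (\<lambda>q. h q $ i)) - \<epsilon> * ip Y Z p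
      + \<kappa> p * (g p (?d i) (\<Phi> Y p) * \<Phi> Z p (\<lambda>q. h q $ i))" for i
  proof -
    have d: "?d i \<in> tangent_space M p" by (rule chart_tangent_in[OF c(2,3)])
    have "\<exists>X. vf X \<and> X p = ?d i" using vector_field_extension[OF p d] by metis
    then have "vf (SOME X. vf X \<and> X p = ?d i) \<and> (SOME X. vf X \<and> X p = ?d i) p = ?d i" by (rule someI_ex)
    then show ?thesis
      by (simp add: curvature_at chart_tangent_coord[OF c(2,3)])
  qed
  then have "ricci M nabla Y Z p = (\<Sum>i\<in>UNIV. \<epsilon> * (g p (?d i) (Z p) * Y p (\<lambda>q. h q $ i)) - \<epsilon> * ip Y Z p
      + \<kappa> p * (g p (?d i) (\<Phi> Y p) * \<Phi> Z p (\<lambda>q. h q $ i)))"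
    unfolding ricci_def tangent_trace_def Let_def c_def[symmetric] by (simp add: c(1))
  also have "\<dots> = \<epsilon> * (\<Sum>i\<in>UNIV. g p (?d i) (Z p) * Y p (\<lambda>q. h q $ i)) - 3 * (\<epsilon> * ip Y Z p)
      + \<kappa> p * (\<Sum>i\<in>UNIV. g p (?d i) (\<Phi> Y p) * \<Phi> Z p (\<lambda>q. h q $ i))"
    by (simp add: sum.distrib sum_subtractf sum_distrib_left)
  also have "\<dots> = \<epsilon> * ip Y Z p - 3 * (\<epsilon> * ip Y Z p) + \<kappa> p * ip (\<Phi> Z) (\<Phi> Y) p"
    by (simp add: coordinate_trace[OF c(2,3)] del: ip_Phi_Phi)
  finally show ?thesis by (simp add: ip_sym[of Z Y] algebra_simps)
qed

lemma constant_curvature_if_kappa_zero: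
  assumes "\<And>p. p \<in> points M \<Longrightarrow> \<kappa> p = 0"
  shows "constant_curvature M g nabla (- \<epsilon>)"
  unfolding constant_curvature_def
proof (intro allI impI ext)
  fix X Y Z p k assume a: "vf X" "vf Y" "vf Z"
  show "curvature M nabla X Y Z p k = scale_field (\<lambda>p. - \<epsilon>)
      (scale_field (\<lambda>p. g p (Y p) (Z p)) X - scale_field (\<lambda>p. g p (X p) (Z p)) Y) p k"
  proof (cases "p \<in> points M")
    case True
    then show ?thesis
      using curvature_at[OF a True, of k] assms[OF True]
      by (simp add: scale_field_apply ip_def algebra_simps)
  next
    case False
    then show ?thesis using a vf_outside[of "curvature M nabla X Y Z" p]
      by (simp add: scale_field_apply vf_outside)
  qed
qed

end

section \<open>The soliton equation\<close>

locale kenmotsu3_soliton = kenmotsu3 M g nabla \<phi> \<xi> \<eta> \<epsilon>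
  for M :: "('a, 3) manifold" and g nabla \<phi> \<xi> \<eta> \<epsilon> +
  fixes V :: "'a vfield" and lam :: real
  assumes V_vf [simp]: "vf V"
    and soliton: "\<And>X Y p. vf X \<Longrightarrow> vf Y \<Longrightarrow> p \<in> points M \<Longrightarrow>
      lie_derivative_metric M V g X Y p + 2 * ricci M nabla X Y p + 2 * lam * g p (X p) (Y p) = 0"
begin

text \<open>
  With \<open>v = \<eta>(V)\<close>, the constant \<open>c\<close> turns out to be \<open>\<xi> v\<close>, the field \<open>W\<close> is the horizontal part of \<open>V\<close>, and \<open>G\<close> is the horizontal
  part of the gradient of \<open>v\<close> (see \<open>dir_v\<close>). The field \<open>Q\<close> is horizontal and measures the rotation of \<open>V\<close> in planes that contain
  \<open>\<xi>\<close>.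
\<close>

definition c :: real where "c = 2 * \<epsilon> - lam"
definition Q :: "'a vfield" where "Q = scale_field (\<lambda>p. c) \<xi> - nabla \<xi> V"
definition v :: "'a \<Rightarrow> real" where "v p = \<epsilon> * ip V \<xi> p"
definition W :: "'a vfield" where "W = V - scale_field v \<xi>"
definition G :: "'a vfield" where "G = scale_field (\<lambda>p. \<epsilon>) (Q + W)"

lemma sf_v [simp]: "sf v" unfolding v_def[abs_def] by simp
lemma Q_vf [simp]: "vf Q" unfolding Q_def by simp
lemma W_vf [simp]: "vf W" unfolding W_def by simp
lemma G_vf [simp]: "vf G" unfolding G_def by simp

text \<open>
  The soliton equation with the Ricci tensor inserted; \<open>\<nabla>\<close> is torsion-free and metric, so the Lie
  derivative of the metric is twice the symmetric part of \<open>\<nabla>V\<close>.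
\<close>

lemma killing:
  assumes [simp]: "vf X" "vf Y" "p \<in> points M"
  shows "ip (nabla X V) Y p + ip X (nabla Y V) p =
    2 * c * ip X Y p - 2 * \<kappa> p * (ip X Y p - \<epsilon> * ip X \<xi> p * ip Y \<xi> p)"
proof -
  have "lie_derivative_metric M V g X Y p = dir V (ip X Y) p - ip (lie_bracket M V X) Y p - ip X (lie_bracket M V Y) p"
    by (simp add: lie_derivative_metric_def dir_def ip_def[abs_def])
  also have "\<dots> = ip (nabla X V) Y p + ip X (nabla Y V) p"
    by (simp add: torsion_free)
  finally show ?thesis
    using soliton[OF assms] ricci_eq[OF assms] unfolding c_def ip_def[of X Y p, symmetric]
    by (simp add: algebra_simps)
qed

lemma nabla_xi_V: "nabla \<xi> V = scale_field (\<lambda>p. c) \<xi> - Q"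
  by (simp add: Q_def)

lemma horizontal_Q [simp]: "horizontal Q"
proof -
  have "ip Q \<xi> p = 0" if "p \<in> points M" for p
    using killing[OF xi_vf xi_vf that] ip_sym[OF xi_vf nabla_vf[OF xi_vf V_vf] that] that
    unfolding Q_def by simp
  then show ?thesis unfolding horizontal_def by simp
qed

lemma horizontal_W [simp]: "horizontal W"
  unfolding horizontal_def by (simp add: W_def v_def)

lemma horizontal_G [simp]: "horizontal G"
  unfolding G_def horizontal_def by simp

lemma dir_v:
  assumes [simp]: "vf X" "p \<in> points M"
  shows "dir X v p = ip X G p + c * \<epsilon> * ip X \<xi> p"
proof -
  have "dir X v p = \<epsilon> * ip (nabla X V) \<xi> p + \<epsilon> * (ip V X p - \<epsilon> * ip X \<xi> p * ip V \<xi> p)"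
    unfolding v_def[abs_def] by (simp add: algebra_simps)
  then show ?thesis
    using killing[of X \<xi> p] by (simp add: nabla_xi_V G_def W_def v_def ip_sym[of V X] algebra_simps)
qed

text \<open>
  What remains of \<open>\<langle>\<nabla>\<^sub>X V, Y\<rangle>\<close> when the symmetric part and the rotation described by \<open>Q\<close> are subtracted. It is
  skew and annihilates \<open>\<xi>\<close>, hence a multiple \<open>w\<close> of the area form.
\<close>

definition \<beta> :: "'a vfield \<Rightarrow> 'a vfield \<Rightarrow> 'a \<Rightarrow> real" where
  "\<beta> X Y p = ip (nabla X V) Y p - c * ip X Y p + \<kappa> p * (ip X Y p - \<epsilon> * ip X \<xi> p * ip Y \<xi> p)
    - \<epsilon> * ip X Q p * ip Y \<xi> p + \<epsilon> * ip X \<xi> p * ip Y Q p"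

lemma beta_area_form:
  assumes p [simp]: "p \<in> points M" and [simp]: "vf X" "vf Y"
    and h [simp]: "horizontal E" and s: "ip E E p \<noteq> 0"
  shows "\<beta> X Y p = \<beta> E (\<Phi> E) p / ip E E p * ip (\<Phi> X) Y p"
proof (rule area_form[OF p _ _ _ _ h s])
  show "\<beta> X Y p = - \<beta> Y X p" if "vf X" "vf Y" for X Y
    using that killing[of X Y p] by (simp add: \<beta>_def ip_sym[of Y X] ip_sym[of X "nabla Y V"] algebra_simps)
  show "\<beta> \<xi> Y p = 0" if "vf Y" for Y
    using that by (simp add: \<beta>_def nabla_xi_V ip_sym[of \<xi> Y] ip_sym[of Q Y] algebra_simps)
  show "\<beta> (X + Y) Z p = \<beta> X Z p + \<beta> Y Z p" if "vf X" "vf Y" "vf Z" for X Y Z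
    using that by (simp add: \<beta>_def) (simp add: algebra_simps)
  show "\<beta> (scale_field f X) Z p = f p * \<beta> X Z p" if "sf f" "vf X" "vf Z" for f X Z
    using that by (simp add: \<beta>_def) (simp add: algebra_simps)
qed simp_all

definition w :: "'a \<Rightarrow> real" where
  "w p = (SOME x. \<forall>X Y. vf X \<longrightarrow> vf Y \<longrightarrow> \<beta> X Y p = x * ip (\<Phi> X) Y p)"

lemma beta_w:
  assumes "p \<in> points M" "vf X" "vf Y"
  shows "\<beta> X Y p = w p * ip (\<Phi> X) Y p"
proof -
  obtain E where E: "horizontal E" "ip E E p \<noteq> 0" by (rule horizontal_frame[OF assms(1)])
  have "\<exists>x. \<forall>X Y. vf X \<longrightarrow> vf Y \<longrightarrow> \<beta> X Y p = x * ip (\<Phi> X) Y p"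
    using beta_area_form[OF assms(1) _ _ E] by blast
  from someI_ex[OF this] show ?thesis using assms unfolding w_def[symmetric] by blast
qed

lemma sf_beta [simp]: "vf X \<Longrightarrow> vf Y \<Longrightarrow> sf (\<lambda>p. \<beta> X Y p)"
  unfolding \<beta>_def by simp

lemma sf_w [simp]: "sf w"
proof (rule smooth_fun_quotient)
  fix p assume p: "p \<in> points M"
  obtain E where h [simp]: "horizontal E" and s: "ip E E p \<noteq> 0"
    by (rule horizontal_frame[OF p])
  have "sf (ip E E)" "sf (\<lambda>q. \<beta> E (\<Phi> E) q)" by simp_all
  moreover have "ip E E q * w q = \<beta> E (\<Phi> E) q" if "q \<in> points M" for q
    using that beta_w[OF that, of E "\<Phi> E"] by simp
  ultimately show "\<exists>d n. sf d \<and> sf n \<and> d p \<noteq> 0 \<and> (\<forall>q\<in>points M. d q * w q = n q)" using s by blast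
qed

lemma nabla_V:
  assumes [simp]: "vf X"
  shows "nabla X V = scale_field (\<lambda>p. c - \<kappa> p) X + scale_field (\<lambda>p. \<kappa> p * (\<epsilon> * ip X \<xi> p)) \<xi>
    + scale_field w (\<Phi> X) + scale_field (\<lambda>p. \<epsilon> * ip X Q p) \<xi> - scale_field (\<lambda>p. \<epsilon> * ip X \<xi> p) Q"
    (is "_ = ?r")
proof (rule vf_eqI)
  fix p Z assume [simp]: "p \<in> points M" "vf Z"
  show "ip (nabla X V) Z p = ip ?r Z p"
    using beta_w[of p X Z] by (simp add: \<beta>_def ip_sym[of \<xi> Z] ip_sym[of Q Z] algebra_simps)
qed simp_all

section \<open>Integrability conditions\<close>

lemma ip_V_left [simp]: "vf X \<Longrightarrow> p \<in> points M \<Longrightarrow> ip V X p = v p * ip \<xi> X p + ip W X p"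
  by (simp add: W_def)

lemma ip_V_right [simp]: "vf X \<Longrightarrow> p \<in> points M \<Longrightarrow> ip X V p = v p * ip X \<xi> p + ip X W p"
  by (simp add: W_def)

text \<open>
  The horizontal component of \<open>R(\<xi>,Y)V\<close>. The term \<open>\<xi> \<kappa>\<close> that appears is replaced by \<open>- 2 \<kappa>\<close>.
\<close>

lemma nabla_Q_horizontal:
  assumes [simp]: "horizontal Y" "horizontal Z" "p \<in> points M"
  shows "ip (nabla Y Q) Z p = (v p - \<kappa> p) * ip Y Z p - (w p + dir \<xi> w p) * ip (\<Phi> Y) Z p"
proof -
  have "ip (curvature M nabla \<xi> Y V) Z p = ip (nabla \<xi> (nabla Y V) - nabla Y (nabla \<xi> V) - nabla (nabla \<xi> Y) V + nabla (nabla Y \<xi>) V) Z p"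
    by (simp only: curvature_eq[OF xi_vf horizontal_vf[OF assms(1)] V_vf])
  then show ?thesis
    by (simp add: curvature_kappa nabla_V kappa_xi) (simp add: algebra_simps)
qed

text \<open>
  The \<open>\<xi>\<close>-component of \<open>R(\<xi>,Y)V\<close>.
\<close>

lemma nabla_xi_Q:
  assumes [simp]: "horizontal Y" "p \<in> points M"
  shows "ip (nabla \<xi> Q) Y p = - ip Y W p"
proof -
  have "ip (curvature M nabla \<xi> Y V) \<xi> p = ip (nabla \<xi> (nabla Y V) - nabla Y (nabla \<xi> V) - nabla (nabla \<xi> Y) V + nabla (nabla Y \<xi>) V) \<xi> p"
    by (simp only: curvature_eq[OF xi_vf horizontal_vf[OF assms(1)] V_vf])
  then show ?thesis
    by (simp add: curvature_kappa nabla_V kappa_xi ip_sym[of \<xi> "nabla Y Q"] ip_sym[of Y "nabla \<xi> Q"]) (simp add: algebra_simps)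
qed

text \<open>
  The \<open>\<xi>\<close>-component of \<open>R(E, \<Phi> E)V\<close> expresses the skew part of \<open>\<nabla>Q\<close> by \<open>w\<close>, whereas \<open>nabla_Q_horizontal\<close>
  expresses it by \<open>w + \<xi> w\<close>.
\<close>

lemma dir_xi_w:
  assumes p [simp]: "p \<in> points M"
  shows "dir \<xi> w p = 0"
proof -
  obtain E where h [simp]: "horizontal E" and s: "ip E E p \<noteq> 0"
    by (rule horizontal_frame[OF p])
  have "ip (curvature M nabla E (\<Phi> E) V) \<xi> p = ip (nabla E (nabla (\<Phi> E) V) - nabla (\<Phi> E) (nabla E V)
      - nabla (nabla E (\<Phi> E)) V + nabla (nabla (\<Phi> E) E) V) \<xi> p"
    by (simp only: curvature_eq[OF horizontal_vf[OF h] Phi_vf[OF horizontal_vf[OF h]] V_vf])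
  then have "ip E E p = 0 \<or> dir \<xi> w p = 0"
    by (simp add: curvature_kappa nabla_V)
       (simp add: nabla_horizontal_xi ip_sym[of E "nabla (\<Phi> E) Q"] ip_sym[of "\<Phi> E" "nabla E Q"] nabla_Q_horizontal
         ip_Phi[of E E] algebra_simps)
  then show ?thesis using s by simp
qed

lemma nabla_Q:
  assumes Y [simp]: "vf Y"
  shows "nabla Y Q = scale_field (\<lambda>p. v p - \<kappa> p) Y - scale_field (\<lambda>p. (v p - \<kappa> p) * (\<epsilon> * ip Y \<xi> p)) \<xi>
    - scale_field w (\<Phi> Y) - scale_field (\<lambda>p. \<epsilon> * ip Y Q p) \<xi> - scale_field (\<lambda>p. \<epsilon> * ip Y \<xi> p) W"
    (is "_ = ?r")
proof (rule vf_eqI)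
  fix p Z assume p [simp]: "p \<in> points M" and Z [simp]: "vf Z"
  have "ip (nabla Y Q) (hor Z) p = ip (nabla (hor Y + scale_field (\<lambda>p. \<epsilon> * ip Y \<xi> p) \<xi>) Q) (hor Z) p"
    by (simp only: hor_split[symmetric])
  also have "\<dots> = ip ?r (hor Z) p"
    by (simp add: nabla_Q_horizontal nabla_xi_Q dir_xi_w ip_sym[of "hor Z" W])
       (simp add: hor_def ip_sym[of Z W] algebra_simps)
  finally have 1: "ip (nabla Y Q) (hor Z) p = ip ?r (hor Z) p" .
  have 2: "ip (nabla Y Q) \<xi> p = ip ?r \<xi> p"
    by (simp add: nabla_horizontal_xi ip_sym[of Q Y]) (simp add: algebra_simps)
  show "ip (nabla Y Q) Z p = ip ?r Z p"
    using 1 2 ip_split[of "nabla Y Q" Z p] ip_split[of ?r Z p] by simp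
qed simp_all

lemma ip_G: "vf X \<Longrightarrow> p \<in> points M \<Longrightarrow> ip X G p = \<epsilon> * ip X Q p + \<epsilon> * ip X W p"
  by (simp add: G_def algebra_simps)

lemma nabla_W:
  assumes [simp]: "vf X"
  shows "nabla X W = scale_field (\<lambda>p. c - \<kappa> p - v p) X
    - scale_field (\<lambda>p. (c - \<kappa> p - v p) * (\<epsilon> * ip X \<xi> p)) \<xi>
    + scale_field w (\<Phi> X) - scale_field (\<lambda>p. \<epsilon> * ip X \<xi> p) Q - scale_field (\<lambda>p. \<epsilon> * ip X W p) \<xi>"
    (is "_ = ?r")
proof (rule vf_eqI)
  fix p Z assume [simp]: "p \<in> points M" "vf Z"
  have "ip (nabla X W) Z p = ip (nabla X V - nabla X (scale_field v \<xi>)) Z p"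
    unfolding W_def by simp
  also have "\<dots> = ip ?r Z p"
    by (simp add: nabla_V dir_v ip_G) (simp add: algebra_simps)
  finally show "ip (nabla X W) Z p = ip ?r Z p" .
qed simp_all

text \<open>
  In the sum of \<open>\<nabla>Q\<close> and \<open>\<nabla>W\<close> the rotation terms \<open>w \<Phi> X\<close> cancel, as they must for the Hessian of \<open>v\<close> to be
  symmetric, and so do the terms with \<open>v\<close>.
\<close>

lemma nabla_G:
  assumes [simp]: "vf X"
  shows "nabla X G = scale_field (\<lambda>p. \<epsilon> * (c - 2 * \<kappa> p)) X
    - scale_field (\<lambda>p. (c - 2 * \<kappa> p) * ip X \<xi> p) \<xi>
    - scale_field (\<lambda>p. \<epsilon> * ip X \<xi> p) G - scale_field (\<lambda>p. \<epsilon> * ip X G p) \<xi>"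
    (is "_ = ?r")
proof (rule vf_eqI)
  fix p Z assume [simp]: "p \<in> points M" "vf Z"
  have "ip (nabla X G) Z p = \<epsilon> * ip (nabla X Q + nabla X W) Z p"
    unfolding G_def by simp
  also have "\<dots> = ip ?r Z p"
    by (simp add: nabla_Q nabla_W ip_G ip_sym[of G Z]) (simp add: algebra_simps ip_sym[of W Z] ip_sym[of Q Z])
  finally show "ip (nabla X G) Z p = ip ?r Z p" .
qed simp_all

lemma curvature_G:
  assumes "vf X" "vf Y" "vf Z" "p \<in> points M"
  shows "ip (curvature M nabla X Y G) Z p = ip (nabla X (nabla Y G) - nabla Y (nabla X G)
    - nabla (nabla X Y) G + nabla (nabla Y X) G) Z p"
  by (simp only: curvature_eq[OF assms(1,2) G_vf])

text \<open>
  The component of \<open>R(\<xi>,E)G\<close> along \<open>E\<close>: it says that the factor \<open>c - 2 \<kappa>\<close> in the Hessian of \<open>v\<close> is multiplied by \<open>-2\<close> under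
  \<open>\<xi>\<close>. As \<open>\<kappa>\<close> has this property, so has the constant \<open>c\<close>.
\<close>

lemma c_zero:
  assumes p [simp]: "p \<in> points M"
  shows "c = 0"
proof -
  obtain E where h [simp]: "horizontal E" and s: "ip E E p \<noteq> 0"
    by (rule horizontal_frame[OF p])
  have "c * ip E E p = 0"
    using curvature_G[OF xi_vf horizontal_vf[OF h] horizontal_vf[OF h] p]
    by (simp add: curvature_kappa nabla_G kappa_xi) (simp add: algebra_simps)
  then show ?thesis using s by simp
qed

text \<open>
  The horizontal component of \<open>R(E, \<Phi> E)G\<close>.
\<close>

lemma dir_kappa:
  assumes h: "horizontal X" and p [simp]: "p \<in> points M"
  shows "dir X \<kappa> p = \<epsilon> / 2 * \<kappa> p * ip X G p"
proof -
  have "dir X \<kappa> p - \<epsilon> / 2 * \<kappa> p * ip X G p = 0"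
  proof (rule horizontal_form_zeroI[OF p h])
    fix E assume h [simp]: "horizontal E" and s: "ip E E p \<noteq> 0"
    have "ip E E p = 0 \<or> \<kappa> p * ip E G p = \<epsilon> * (2 * dir E \<kappa> p)"
      using curvature_G[OF horizontal_vf[OF h] Phi_vf[OF horizontal_vf[OF h]] Phi_vf[OF horizontal_vf[OF h]] p]
      by (simp add: curvature_kappa nabla_G)
         (simp add: c_zero[OF p] algebra_simps ip_Phi[of E E] ip_sym[of G E])
    then show "dir E \<kappa> p - \<epsilon> / 2 * \<kappa> p * ip E G p = 0" using s by (simp add: mult.assoc)
  next
    fix X Y assume [simp]: "vf X" "vf Y"
    show "(dir (X + Y) \<kappa> p - \<epsilon> / 2 * \<kappa> p * ip (X + Y) G p) = (dir X \<kappa> p - \<epsilon> / 2 * \<kappa> p * ip X G p) + (dir Y \<kappa> p - \<epsilon> / 2 * \<kappa> p * ip Y G p)" by simp (simp add: algebra_simps add_divide_distrib)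
  next
    fix f X assume [simp]: "sf f" "vf X"
    show "(dir (scale_field f X) \<kappa> p - \<epsilon> / 2 * \<kappa> p * ip (scale_field f X) G p) = f p * ((dir X \<kappa> p - \<epsilon> / 2 * \<kappa> p * ip X G p))" by simp (simp add: algebra_simps)
  qed
  then show ?thesis by simp
qed

text \<open>
  The horizontal component of \<open>R(E, \<Phi> E)V\<close>.
\<close>

lemma dir_w:
  assumes h: "horizontal X" and p [simp]: "p \<in> points M"
  shows "dir X w p = (1 + \<epsilon> / 2 * \<kappa> p) * ip (\<Phi> X) G p - \<kappa> p * ip (\<Phi> X) W p"
proof -
  have "dir X w p - ((1 + \<epsilon> / 2 * \<kappa> p) * ip (\<Phi> X) G p - \<kappa> p * ip (\<Phi> X) W p) = 0"
  proof (rule horizontal_form_zeroI[OF p h, where \<alpha> = "\<lambda>X. dir X w p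
        - ((1 + \<epsilon> / 2 * \<kappa> p) * ip (\<Phi> X) G p - \<kappa> p * ip (\<Phi> X) W p)"])
    fix E assume h [simp]: "horizontal E" and s: "ip E E p \<noteq> 0"
    have "ip (curvature M nabla E (\<Phi> E) V) E p = ip (nabla E (nabla (\<Phi> E) V) - nabla (\<Phi> E) (nabla E V)
      - nabla (nabla E (\<Phi> E)) V + nabla (nabla (\<Phi> E) E) V) E p"
      by (simp only: curvature_eq[OF horizontal_vf[OF h] Phi_vf[OF horizontal_vf[OF h]] V_vf])
    moreover have "ip (\<Phi> V) E p = - ip (\<Phi> E) W p"
      using ip_Phi[of E V p] ip_sym[of E "\<Phi> V" p] by simp
    ultimately have "ip E E p * dir E w p + ip E E p * (\<kappa> p * ip (\<Phi> E) W p)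
        = \<epsilon> * (ip E E p * ip (\<Phi> E) W p) + (\<epsilon> * (ip E E p * ip (\<Phi> E) Q p)
        + (ip E E p * (\<kappa> p * ip (\<Phi> E) W p) + ip E E p * (\<kappa> p * ip (\<Phi> E) Q p)) / 2)"
      by (simp add: curvature_kappa nabla_V dir_kappa)
         (simp add: c_zero[OF p] ip_G algebra_simps ip_Phi[of E E])
    then have "ip E E p * (dir E w p - ((1 + \<epsilon> / 2 * \<kappa> p) * (\<epsilon> * ip (\<Phi> E) Q p + \<epsilon> * ip (\<Phi> E) W p)
        - \<kappa> p * ip (\<Phi> E) W p)) = 0"
      using eps_sq(1) by algebra
    then show "dir E w p - ((1 + \<epsilon> / 2 * \<kappa> p) * ip (\<Phi> E) G p - \<kappa> p * ip (\<Phi> E) W p) = 0"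
      using s by (simp add: ip_G)
  next
    fix X Y assume [simp]: "vf X" "vf Y"
    show "(dir (X + Y) w p - ((1 + \<epsilon> / 2 * \<kappa> p) * ip (\<Phi> (X + Y)) G p - \<kappa> p * ip (\<Phi> (X + Y)) W p)) = (dir X w p - ((1 + \<epsilon> / 2 * \<kappa> p) * ip (\<Phi> X) G p - \<kappa> p * ip (\<Phi> X) W p)) + (dir Y w p - ((1 + \<epsilon> / 2 * \<kappa> p) * ip (\<Phi> Y) G p - \<kappa> p * ip (\<Phi> Y) W p))" by simp (simp add: algebra_simps add_divide_distrib)
  next
    fix f X assume [simp]: "sf f" "vf X"
    show "(dir (scale_field f X) w p - ((1 + \<epsilon> / 2 * \<kappa> p) * ip (\<Phi> (scale_field f X)) G p - \<kappa> p * ip (\<Phi> (scale_field f X)) W p)) = f p * ((dir X w p - ((1 + \<epsilon> / 2 * \<kappa> p) * ip (\<Phi> X) G p - \<kappa> p * ip (\<Phi> X) W p)))" by simp (simp add: algebra_simps)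
  qed
  then show ?thesis by simp
qed

text \<open>
  Both sides annihilate \<open>\<xi>\<close>, so the formula extends to arbitrary fields. This is what second derivatives
  of \<open>w\<close> require, since \<open>\<nabla>\<^sub>X Y\<close> is not horizontal.
\<close>

lemma dir_w_field:
  assumes [simp]: "vf X" and p [simp]: "p \<in> points M"
  shows "dir X w p = (1 + \<epsilon> / 2 * \<kappa> p) * ip (\<Phi> X) G p - \<kappa> p * ip (\<Phi> X) W p"
proof -
  have "dir X w p = dir (hor X + scale_field (\<lambda>p. \<epsilon> * ip X \<xi> p) \<xi>) w p"
    by (simp only: hor_split[symmetric])
  also have "\<dots> = dir (hor X) w p" by (simp add: dir_xi_w)
  also have "\<Phi> (hor X) = \<Phi> X" by (simp add: hor_def fun_eq_iff scale_field_apply)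
  then have "dir (hor X) w p = (1 + \<epsilon> / 2 * \<kappa> p) * ip (\<Phi> X) G p - \<kappa> p * ip (\<Phi> X) W p"
    using dir_w[of "hor X" p] by simp
  finally show ?thesis .
qed

section \<open>Vanishing of the curvature excess\<close>

text \<open>
  The gradient of \<open>w\<close> is \<open>\<Phi>\<close> applied to a combination of \<open>W\<close> and \<open>G\<close>, so the symmetry of its Hessian says that the
  horizontal divergence of this combination vanishes.
\<close>

lemma kappa_identity_1:
  assumes p [simp]: "p \<in> points M"
  shows "\<kappa> p * (2 * \<epsilon> * ip G W p - 8 * v p - ip G G p + 16 * \<epsilon>) = 0"
proof -
  obtain E where h [simp]: "horizontal E" and s: "ip E E p \<noteq> 0"
    by (rule horizontal_frame[OF p])
  have dd: "dir X (dir Y w) p =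
      dir X (\<lambda>q. (1 + \<epsilon> / 2 * \<kappa> q) * ip (\<Phi> Y) G q - \<kappa> q * ip (\<Phi> Y) W q) p"
    if "vf X" "vf Y" for X Y
    using that by (intro dir_cong) (simp_all add: dir_w_field)
  have "dir E (dir (\<Phi> E) w) p - dir (\<Phi> E) (dir E w) p =
      dir (nabla E (\<Phi> E)) w p - dir (nabla (\<Phi> E) E) w p"
    by (rule dir_commute) simp_all
  then have "\<epsilon> * (4 * (ip E E p * \<kappa> p)) + (\<epsilon> * (\<kappa> p * (ip E W p * ip E G p)) / 2 +
      \<epsilon> * (\<kappa> p * (ip (\<Phi> E) W p * ip (\<Phi> E) G p)) / 2) =
     2 * (ip E E p * (v p * \<kappa> p)) + (\<kappa> p * (ip E G p * ip E G p) / 4 +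
      \<kappa> p * (ip (\<Phi> E) G p * ip (\<Phi> E) G p) / 4)"
    by (simp add: dd dir_w_field nabla_G nabla_W dir_kappa c_zero[OF p])
       (simp add: algebra_simps ip_Phi[of E E])
  moreover have "ip E E p * ip G W p = ip E G p * ip E W p + ip (\<Phi> E) G p * ip (\<Phi> E) W p"
    "ip E E p * ip G G p = ip E G p * ip E G p + ip (\<Phi> E) G p * ip (\<Phi> E) G p"
    by (simp_all add: frame_ip[OF h])
  ultimately have "ip E E p * (\<kappa> p * (2 * \<epsilon> * ip G W p - 8 * v p - ip G G p + 16 * \<epsilon>)) = 0"
    by algebra
  then show ?thesis using s by simp
qed

text \<open>
  The derivative of the previous identity along \<open>G\<close>, which avoids the unknown \<open>w\<close> because \<open>\<langle>\<Phi>G,G\<rangle> = 0\<close>; then \<open>\<langle>G,W\<rangle>\<close>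
  is eliminated.
\<close>

lemma kappa_identity_2:
  assumes p [simp]: "p \<in> points M"
  shows "\<kappa> p * ((ip G G p + 8 * \<kappa> p) * (v p + 4 * \<epsilon>) - 48 * \<epsilon> * \<kappa> p) = 0"
proof -
  have "dir G (\<lambda>q. \<kappa> q * (2 * \<epsilon> * ip G W q - 8 * v q - ip G G q + 16 * \<epsilon>)) p = dir G (\<lambda>q. 0) p"
    by (rule dir_cong) (simp_all add: kappa_identity_1)
  then have "\<kappa> p * (2 * \<epsilon> * ((- \<kappa> p - v p) * ip G G p - \<epsilon> * (2 * \<kappa> p) * ip G W p) - 8 * ip G G p
        + 4 * (\<epsilon> * (\<kappa> p * ip G G p)))
      + \<epsilon> * \<kappa> p * ip G G p * (2 * \<epsilon> * ip G W p - 8 * v p - ip G G p + 16 * \<epsilon>) / 2 = 0"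
    by (simp add: nabla_G nabla_W dir_v dir_kappa c_zero[OF p] ip_Phi[of G G])
  then show ?thesis using kappa_identity_1[OF p] eps_sq(1) by algebra
qed

text \<open>
  The sum \<open>\<langle>G,G\<rangle> + 8 \<kappa>\<close> in the previous identity is constant in horizontal directions, so only \<open>v\<close> and the last
  term are differentiated.
\<close>

lemma kappa_identity_3:
  assumes [simp]: "horizontal X" and p [simp]: "p \<in> points M"
  shows "\<kappa> p * (ip G G p - 16 * \<kappa> p) * ip X G p = 0"
proof -
  have "dir X (\<lambda>q. \<kappa> q * ((ip G G q + 8 * \<kappa> q) * (v q + 4 * \<epsilon>) - 48 * \<epsilon> * \<kappa> q)) p = dir X (\<lambda>q. 0) p"
    by (rule dir_cong) (simp_all add: kappa_identity_2)
  then have "\<kappa> p * ((ip G G p + 8 * \<kappa> p) * ip X G p - 24 * (\<kappa> p * ip X G p))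
     + \<epsilon> * \<kappa> p * ip X G p * ((ip G G p + 8 * \<kappa> p) * (v p + 4 * \<epsilon>) - 48 * \<epsilon> * \<kappa> p) / 2 = 0"
    by (simp add: nabla_G nabla_W dir_v dir_kappa c_zero[OF p] ip_sym[of G X])
  then show ?thesis using kappa_identity_2[OF p] by algebra
qed

text \<open>
  One more derivative, now with \<open>\<langle>G,G\<rangle> - 16 \<kappa>\<close>, whose derivative along \<open>X\<close> is \<open>-12 \<epsilon> \<kappa> \<langle>X,G\<rangle>\<close>. After multiplication by \<open>\<langle>X,G\<rangle>\<close>
  all other terms vanish by the previous identity, and \<open>\<kappa>\<^sup>2 \<langle>X,G\<rangle>\<^sup>3 = 0\<close> is left.
\<close>

lemma kappa_gradient_horizontal:
  assumes [simp]: "horizontal X" and p [simp]: "p \<in> points M"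
  shows "\<kappa> p * ip X G p = 0"
proof -
  have "dir X (\<lambda>q. \<kappa> q * (ip G G q - 16 * \<kappa> q) * ip X G q) p = dir X (\<lambda>q. 0) p"
    by (rule dir_cong) (simp_all add: kappa_identity_3)
  then have "\<kappa> p * (ip G G p - 16 * \<kappa> p) * (ip (nabla X X) G p - \<epsilon> * (2 * \<kappa> p) * ip X X p)
     + (\<epsilon> * \<kappa> p * ip X G p * (ip G G p - 16 * \<kappa> p) / 2
       - \<kappa> p * (12 * (\<epsilon> * (\<kappa> p * ip X G p)))) * ip X G p = 0"
    by (simp add: nabla_G nabla_W dir_v dir_kappa c_zero[OF p] ip_sym[of G X])
  then have "\<epsilon> * (\<kappa> p * \<kappa> p * (ip X G p * ip X G p * ip X G p)) = 0"
    using kappa_identity_3[OF assms] by algebra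
  then show ?thesis by simp
qed

lemma kappa_gradient:
  assumes [simp]: "vf X" and p [simp]: "p \<in> points M"
  shows "\<kappa> p * ip X G p = 0"
  using kappa_gradient_horizontal[of "hor X" p] by simp

text \<open>
  Differentiating \<open>\<kappa> \<langle>E,G\<rangle> = 0\<close> along \<open>E\<close> leaves \<open>\<kappa> \<langle>E, \<nabla>\<^sub>E G\<rangle> = - 2 \<epsilon> \<kappa>\<^sup>2 \<langle>E,E\<rangle>\<close>.
\<close>

lemma kappa_zero:
  assumes p [simp]: "p \<in> points M"
  shows "\<kappa> p = 0"
proof -
  obtain E where h [simp]: "horizontal E" and s: "ip E E p \<noteq> 0"
    by (rule horizontal_frame[OF p])
  have "dir E (\<lambda>q. \<kappa> q * ip E G q) p = dir E (\<lambda>q. 0) p"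
    by (rule dir_cong) (simp_all add: kappa_gradient)
  then have "\<kappa> p * (ip (nabla E E) G p - \<epsilon> * (2 * \<kappa> p) * ip E E p) + \<epsilon> * \<kappa> p * ip E G p * ip E G p / 2 = 0"
    by (simp add: nabla_G dir_kappa c_zero[OF p])
  then have "\<epsilon> * (\<kappa> p * \<kappa> p) * ip E E p = 0"
    using kappa_gradient[OF horizontal_vf[OF h] p] kappa_gradient[OF nabla_vf[OF horizontal_vf[OF h] horizontal_vf[OF h]] p]
    by algebra
  then show ?thesis using s by simp
qed

end

theorem theorem8:
  fixes M :: "('a, 3) manifold"
    and \<phi> :: "'a \<Rightarrow> 'a tangent \<Rightarrow> 'a tangent"
    and \<xi> V :: "'a vfield"
    and \<eta> :: "'a \<Rightarrow> 'a tangent \<Rightarrow> real"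
    and g :: "'a \<Rightarrow> 'a tangent \<Rightarrow> 'a tangent \<Rightarrow> real"
    and nabla :: "'a vfield \<Rightarrow> 'a vfield \<Rightarrow> 'a vfield"
    and \<epsilon> :: real
  assumes "smooth_manifold M"
    and "levi_civita M g nabla"
    and "kenmotsu_pseudo_metric M \<phi> \<xi> \<eta> g \<epsilon> nabla"
    and "ricci_soliton M g nabla V"
  shows "constant_curvature M g nabla (- \<epsilon>)"
proof -
  obtain lam where lam: "\<forall>X Y. vector_field M X \<longrightarrow> vector_field M Y \<longrightarrow> (\<forall>p\<in>points M.
      lie_derivative_metric M V g X Y p + 2 * ricci M nabla X Y p + 2 * lam * g p (X p) (Y p) = 0)"
    using assms(4) unfolding ricci_soliton_def by blast
  interpret kenmotsu3_soliton M g nabla \<phi> \<xi> \<eta> \<epsilon> V lam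
  proof unfold_locales
    show "pseudo_riemannian_metric M g"
      using assms(3) by (simp add: kenmotsu_pseudo_metric_def almost_contact_pseudo_metric_def)
    show "vector_field M V" using assms(4) by (simp add: ricci_soliton_def)
  qed (use assms lam in simp_all)
  show ?thesis by (rule constant_curvature_if_kappa_zero) (rule kappa_zero)
qed

end
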